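(* For every $r\ge0$, the formal power series $M_r(x)$ is a rational function of $x$ and $\sqrt{1-4x^2}$; that is, $M_r(x)\in\mathbb Q\big(x,\sqrt{1-4x^2}\big)$.
   Context: An occurrence of $132$ in $\pi=\pi_1\cdots\pi_n$ is a triple $i<j<k$ with $\pi_i<\pi_k<\pi_j$. $\operatorname{sign}(\pi)=(-1)^{\#\text{inversions}}$, and the empty permutation has sign $1$. $M_r(x)=\sum_{n\ge0}\sum_{\pi\in\mathfrak S_n \text{ with exactly } r \text{ occurrences of } 132}\operatorname{sign}(\pi)\,x^n$, i.e. the number of even minus the number of odd such permutations, as generating function. $\sqrt{1-4x^2}$ denotes the power series with constant term $1$. *)

theory Defs
  imports
    "HOL-Combinatorics.Permutations"
    "HOL-Computational_Algebra.Computational_Algebra"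
begin

definition occ132 :: "nat \<Rightarrow> (nat \<Rightarrow> nat) \<Rightarrow> nat" where
  "occ132 n p = card {(i, j, k). 1 \<le> i \<and> i < j \<and> j < k \<and> k \<le> n \<and> p i < p k \<and> p k < p j}"

definition inversions :: "nat \<Rightarrow> (nat \<Rightarrow> nat) \<Rightarrow> nat" where
  "inversions n p = card {(i, j). 1 \<le> i \<and> i < j \<and> j \<le> n \<and> p i > p j}"

definition sgn_perm :: "nat \<Rightarrow> (nat \<Rightarrow> nat) \<Rightarrow> int" where
  "sgn_perm n p = (-1) ^ inversions n p"

definition M :: "nat \<Rightarrow> rat fps" where
  "M r = Abs_fps (\<lambda>n. of_int (\<Sum>p | p permutes {1..n} \<and> occ132 n p = r. sgn_perm n p))"

text \<open>The root function passed to \<^const>\<open>fps_radical\<close> only prescribes the constant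
  term of the result, here 1; the lemmas below characterise the series.\<close>

definition sqrt_series :: "rat fps" where
  "sqrt_series = fps_radical (\<lambda>_ _. 1) 2 (1 - 4 * fps_X ^ 2)"

lemma sqrt_series_nth_0: "fps_nth sqrt_series 0 = 1"
  by (simp add: sqrt_series_def)

lemma sqrt_series_square: "sqrt_series ^ 2 = 1 - 4 * fps_X ^ 2"
  using power_radical[of "1 - 4 * fps_X ^ 2 :: rat fps" "\<lambda>_ _. 1" 1]
  by (simp add: sqrt_series_def numeral_2_eq_2)

lemma sqrt_series_unique:
  assumes "f ^ 2 = 1 - 4 * fps_X ^ 2" and "fps_nth f 0 = 1"
  shows "f = sqrt_series"
proof -
  have "f = sqrt_series \<or> f = - sqrt_series"
    using assms(1) sqrt_series_square by (metis power2_eq_iff)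
  moreover have "f \<noteq> - sqrt_series"
    using assms(2) sqrt_series_nth_0 by auto
  ultimately show ?thesis by blast
qed

text \<open>\<open>eval2 P s\<close> is $P(x, s)$ in $\mathbf{Q}((x))$: the outer variable of the bivariate
  polynomial is replaced by \<open>s\<close>, the inner one by the series variable $x$.\<close>

definition eval2 :: "rat poly poly \<Rightarrow> rat fls \<Rightarrow> rat fls" where
  "eval2 P s = poly (map_poly (\<lambda>p. fps_to_fls (fps_of_poly p)) P) s"

text \<open>The subfield $\mathbf{Q}(x, s)$ of $\mathbf{Q}((x))$.\<close>

definition rational_functions_of_X_and :: "rat fls \<Rightarrow> rat fls set" where
  "rational_functions_of_X_and s = {eval2 P s / eval2 Q s | P Q. eval2 Q s \<noteq> 0}"

end

theory Submission
  imports Defs "HOL-Library.Infinite_Set" "HOL-Library.FuncSet"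
begin

text \<open>
  Following Mansour and Vainshtein, let the kernel of a permutation be the connected component of
  its maximum in the hypergraph whose edges are the occurrences of 132. No kernel point lies to the
  lower left of a point outside the kernel, so two points outside the kernel that form an increasing
  pair lie in the same cell of the grid cut out by the kernel. Hence each cell is a block, occurrences
  of 132 lie either inside the kernel or inside one cell, and the permutation is an inflation of a
  reduced pattern having at most one point per cell. Only finitely many patterns contain between 1
  and \<open>r\<close> occurrences, and those leave fewer than \<open>r\<close> occurrences for the cells. If \<open>E\<close> and \<open>O\<close>
  denote the even and odd parts of $\sum_r M_r q^r$, the remaining patterns, with kernel reduced to the
  maximum, contribute $x (E^2 + O^2)$ to \<open>O\<close> and nothing to \<open>E\<close>, by cancellation. For $r = 0$ this
  gives $1 - 2 x O_0 = \sqrt{1 - 4 x^2}$; for $r > 0$ it is linear in \<open>O\<^sub>r\<close> with leading coefficient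
  $1 - 2 x O_0$.
\<close>

section \<open>Permutations of finite sets of naturals\<close>

text \<open>The obstacle is the sign. Apart from those of the pattern itself, occurrences of 132 add
  up over the blocks of an inflation, but inversions do not: each inversion (i, j) of the pattern
  contributes the product of the sizes of blocks i and j, so the sum over all block sizes is not a
  product of power series. Only the parity of that product matters, and it is odd exactly when both
  sizes are odd. Once the set S of odd blocks is prescribed, the sign is a constant and the sum over
  sizes factors; this is why even and odd sizes are tracked separately. The parity of card S is the
  parity of the total size, so every S feeds only one of E and O. Hence the even part at level r is
  settled by smaller levels, and the odd part at level r occurs in its own equation only through the
  two extreme terms of the convolution for the square of O.\<close>

definition occs :: "nat set \<Rightarrow> (nat \<Rightarrow> nat) \<Rightarrow> (nat \<times> nat \<times> nat) set" where
  "occs A f = {(i, j, k). i \<in> A \<and> j \<in> A \<and> k \<in> A \<and> i < j \<and> j < k \<and> f i < f k \<and> f k < f j}"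

definition invs :: "nat set \<Rightarrow> (nat \<Rightarrow> nat) \<Rightarrow> (nat \<times> nat) set" where
  "invs A f = {(i, j). i \<in> A \<and> j \<in> A \<and> i < j \<and> f j < f i}"

text \<open>Extensionality makes functions that agree on \<open>A\<close> equal, so a sum over
  \<open>bijs A B\<close> counts every bijection once; it also fits the function sets
  \<open>PiE\<close> in which blocks are chosen independently.\<close>

definition bijs :: "nat set \<Rightarrow> nat set \<Rightarrow> (nat \<Rightarrow> nat) set" where
  "bijs A B = {f \<in> extensional A. bij_betw f A B}"

text \<open>Here \<open>fps_X\<close> is the variable q that marks occurrences. The size variable x
  appears later, as the outer variable of \<open>rat fps fps\<close>.\<close>

definition wt :: "nat set \<Rightarrow> (nat \<Rightarrow> nat) \<Rightarrow> rat fps" where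
  "wt A f = (- 1) ^ card (invs A f) * fps_X ^ card (occs A f)"

definition perm_sum :: "nat \<Rightarrow> rat fps" where
  "perm_sum n = (\<Sum>f\<in>bijs {..<n} {..<n}. wt {..<n} f)"

lemma finite_occs [simp]: "finite A \<Longrightarrow> finite (occs A f)"
  by (rule finite_subset[of _ "A \<times> A \<times> A"]) (auto simp: occs_def)

lemma finite_invs [simp]: "finite A \<Longrightarrow> finite (invs A f)"
  by (rule finite_subset[of _ "A \<times> A"]) (auto simp: invs_def)

lemma finite_bijs [simp]:
  assumes "finite A" "finite B"
  shows "finite (bijs A B)"
proof (rule finite_subset)
  show "bijs A B \<subseteq> (A \<rightarrow>\<^sub>E B)"
    by (auto simp: bijs_def PiE_def bij_betw_def)
qed (simp add: assms finite_PiE)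

lemma occs_cong: "(\<And>x. x \<in> A \<Longrightarrow> f x = g x) \<Longrightarrow> occs A f = occs A g"
  by (auto simp: occs_def)

lemma invs_cong: "(\<And>x. x \<in> A \<Longrightarrow> f x = g x) \<Longrightarrow> invs A f = invs A g"
  by (auto simp: invs_def)

lemma wt_cong: "(\<And>x. x \<in> A \<Longrightarrow> f x = g x) \<Longrightarrow> wt A f = wt A g"
  using occs_cong[of A f g] invs_cong[of A f g] by (simp add: wt_def)

lemma occs_order_iso:
  assumes "bij_betw h A' A" "strict_mono_on A' h"
    and "\<And>x y. x \<in> A' \<Longrightarrow> y \<in> A' \<Longrightarrow> g x < g y \<longleftrightarrow> f (h x) < f (h y)"
  shows "card (occs A' g) = card (occs A f)"
proof -
  have "bij_betw (\<lambda>(i, j, k). (h i, h j, h k)) (occs A' g) (occs A f)"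
    unfolding bij_betw_def
  proof
    have inj: "inj_on h A'" and im: "h ` A' = A"
      using assms(1) by (auto simp: bij_betw_def)
    show "inj_on (\<lambda>(i, j, k). (h i, h j, h k)) (occs A' g)"
      using inj by (auto simp: occs_def inj_on_def)
    have less: "h x < h y \<longleftrightarrow> x < y" if "x \<in> A'" "y \<in> A'" for x y
      using that assms(2) by (simp add: strict_mono_on_less)
    show "(\<lambda>(i, j, k). (h i, h j, h k)) ` occs A' g = occs A f"
    proof
      show "(\<lambda>(i, j, k). (h i, h j, h k)) ` occs A' g \<subseteq> occs A f"
        using im assms(3) by (auto simp: occs_def less)
      show "occs A f \<subseteq> (\<lambda>(i, j, k). (h i, h j, h k)) ` occs A' g"
      proof
        fix t assume "t \<in> occs A f"
        then obtain i j k where t: "t = (h i, h j, h k)" "i \<in> A'" "j \<in> A'" "k \<in> A'"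
          "(h i, h j, h k) \<in> occs A f"
          using im by (auto simp: occs_def)
        then have "(i, j, k) \<in> occs A' g"
          using assms(3) by (auto simp: occs_def less)
        then show "t \<in> (\<lambda>(i, j, k). (h i, h j, h k)) ` occs A' g"
          using t(1) by force
      qed
    qed
  qed
  then show ?thesis by (rule bij_betw_same_card)
qed

lemma invs_order_iso:
  assumes "bij_betw h A' A" "strict_mono_on A' h"
    and "\<And>x y. x \<in> A' \<Longrightarrow> y \<in> A' \<Longrightarrow> g x < g y \<longleftrightarrow> f (h x) < f (h y)"
  shows "card (invs A' g) = card (invs A f)"
proof -
  have "bij_betw (\<lambda>(i, j). (h i, h j)) (invs A' g) (invs A f)"
    unfolding bij_betw_def
  proof
    have inj: "inj_on h A'" and im: "h ` A' = A"
      using assms(1) by (auto simp: bij_betw_def)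
    show "inj_on (\<lambda>(i, j). (h i, h j)) (invs A' g)"
      using inj by (auto simp: invs_def inj_on_def)
    have less: "h x < h y \<longleftrightarrow> x < y" if "x \<in> A'" "y \<in> A'" for x y
      using that assms(2) by (simp add: strict_mono_on_less)
    show "(\<lambda>(i, j). (h i, h j)) ` invs A' g = invs A f"
    proof
      show "(\<lambda>(i, j). (h i, h j)) ` invs A' g \<subseteq> invs A f"
        using im assms(3) by (auto simp: invs_def less)
      show "invs A f \<subseteq> (\<lambda>(i, j). (h i, h j)) ` invs A' g"
      proof
        fix t assume "t \<in> invs A f"
        then obtain i j where t: "t = (h i, h j)" "i \<in> A'" "j \<in> A'"
          "(h i, h j) \<in> invs A f"
          using im by (auto simp: invs_def)
        then have "(i, j) \<in> invs A' g"
          using assms(3) by (auto simp: invs_def less)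
        then show "t \<in> (\<lambda>(i, j). (h i, h j)) ` invs A' g"
          using t(1) by force
      qed
    qed
  qed
  then show ?thesis by (rule bij_betw_same_card)
qed

lemma wt_order_iso:
  assumes "bij_betw h A' A" "strict_mono_on A' h"
    and "\<And>x y. x \<in> A' \<Longrightarrow> y \<in> A' \<Longrightarrow> g x < g y \<longleftrightarrow> f (h x) < f (h y)"
  shows "wt A' g = wt A f"
proof -
  have "card (occs A' g) = card (occs A f)" by (rule occs_order_iso) (use assms in auto)
  moreover have "card (invs A' g) = card (invs A f)" by (rule invs_order_iso) (use assms in auto)
  ultimately show ?thesis by (simp add: wt_def)
qed

text \<open>Composing with the increasing enumerations of \<open>A\<close> and \<open>B\<close>
  changes no comparison, so only the common cardinality matters. This lets each block of an
  inflation contribute a factor that depends on its size alone.\<close>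

lemma sum_wt_bijs:
  assumes "finite A" "finite B" "card A = n" "card B = n"
  shows "(\<Sum>f\<in>bijs A B. wt A f) = perm_sum n"
proof -
  obtain h where h: "bij_betw h {..<n} A" "strict_mono_on {..<n} h"
    using ex_bij_betw_strict_mono_card[OF assms(1)] assms(3) by blast
  obtain k where k: "bij_betw k {..<n} B" "strict_mono_on {..<n} k"
    using ex_bij_betw_strict_mono_card[OF assms(2)] assms(4) by blast
  have h': "bij_betw (inv_into {..<n} h) A {..<n}" and k': "bij_betw (inv_into {..<n} k) B {..<n}"
    using h(1) k(1) by (auto intro: bij_betw_inv_into)
  have hA: "h x \<in> A" if "x < n" for x using h(1) that by (auto simp: bij_betw_def)
  have kB: "k x \<in> B" if "x < n" for x using k(1) that by (auto simp: bij_betw_def)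
  have iA: "inv_into {..<n} h x < n" if "x \<in> A" for x using h' that by (auto simp: bij_betw_def)
  have iB: "inv_into {..<n} k x < n" if "x \<in> B" for x using k' that by (auto simp: bij_betw_def)
  have hi: "h (inv_into {..<n} h x) = x" if "x \<in> A" for x
    using h(1) that by (simp add: bij_betw_inv_into_right)
  have ki: "k (inv_into {..<n} k x) = x" if "x \<in> B" for x
    using k(1) that by (simp add: bij_betw_inv_into_right)
  have ih: "inv_into {..<n} h (h x) = x" if "x < n" for x
    using h(1) that by (simp add: bij_betw_inv_into_left)
  have ik: "inv_into {..<n} k (k x) = x" if "x < n" for x
    using k(1) that by (simp add: bij_betw_inv_into_left)
  define F where "F = (\<lambda>g. \<lambda>x\<in>A. k (g (inv_into {..<n} h x)))"
  define G where "G = (\<lambda>f. \<lambda>x\<in>{..<n}. inv_into {..<n} k (f (h x)))"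
  have vg: "g x < n" if "g \<in> bijs {..<n} {..<n}" "x < n" for g x
    using that by (auto simp: bijs_def bij_betw_def)
  have vf: "f x \<in> B" if "f \<in> bijs A B" "x \<in> A" for f x
    using that by (auto simp: bijs_def bij_betw_def)
  have "perm_sum n = (\<Sum>f\<in>bijs A B. wt A f)"
    unfolding perm_sum_def
  proof (rule sum.reindex_bij_witness[where i = G and j = F])
    fix g assume g: "g \<in> bijs {..<n} {..<n}"
    show "G (F g) = g"
    proof
      fix x show "G (F g) x = g x"
        using g vg[OF g] by (cases "x < n") (auto simp: G_def F_def hA ih ik bijs_def extensional_def)
    qed
    have "bij_betw g {..<n} {..<n}" using g by (simp add: bijs_def)
    then have "bij_betw (k \<circ> (g \<circ> inv_into {..<n} h)) A B"
      using bij_betw_trans[OF bij_betw_trans[OF h'] k(1)] by blast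
    then have "bij_betw (F g) A B"
      by (rule bij_betw_cong[THEN iffD1, rotated]) (simp add: F_def)
    then show "F g \<in> bijs A B" by (simp add: bijs_def F_def)
    show "wt A (F g) = wt {..<n} g"
    proof (rule wt_order_iso[symmetric, OF h])
      fix x y assume "x \<in> {..<n}" "y \<in> {..<n}"
      then show "g x < g y \<longleftrightarrow> F g (h x) < F g (h y)"
        using k(2) vg[OF g] by (simp add: F_def hA ih strict_mono_on_less)
    qed
  next
    fix f assume f: "f \<in> bijs A B"
    show "F (G f) = f"
    proof
      fix x show "F (G f) x = f x"
        using f vf[OF f] by (cases "x \<in> A") (auto simp: G_def F_def iA hi ki bijs_def extensional_def)
    qed
    have "bij_betw f A B" using f by (simp add: bijs_def)
    then have "bij_betw (inv_into {..<n} k \<circ> (f \<circ> h)) {..<n} {..<n}"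
      using bij_betw_trans[OF bij_betw_trans[OF h(1)] k'] by blast
    then have "bij_betw (G f) {..<n} {..<n}"
      by (rule bij_betw_cong[THEN iffD1, rotated]) (simp add: G_def)
    then show "G f \<in> bijs {..<n} {..<n}" by (simp add: bijs_def G_def)
  qed
  then show ?thesis by simp
qed

text \<open>The recurrence is stated for one size and all occurrence numbers at once,
  \<open>M r\<close> for one occurrence number and all sizes; hence the exchange of indices.
  Restriction and extension by the identity relate \<open>bijs\<close> to
  \<open>permutes\<close>.\<close>

lemma M_nth: "M r $ n = perm_sum n $ r"
proof -
  let ?A = "{1..n}"
  have "perm_sum n $ r = (\<Sum>f\<in>bijs ?A ?A. wt ?A f $ r)"
    using sum_wt_bijs[of ?A ?A n] by (simp flip: fps_sum_nth)
  also have "\<dots> = (\<Sum>p | p permutes ?A. wt ?A p $ r)"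
  proof (rule sum.reindex_bij_witness[where i = "\<lambda>p. restrict p ?A" and j = "\<lambda>f x. if x \<in> ?A then f x else x"])
    fix f assume f: "f \<in> bijs ?A ?A"
    then show "restrict (\<lambda>x. if x \<in> ?A then f x else x) ?A = f"
      by (auto simp: bijs_def extensional_def restrict_def fun_eq_iff)
    have "bij_betw (\<lambda>x. if x \<in> ?A then f x else x) ?A ?A"
      using f by (subst bij_betw_cong[where g = f]) (auto simp: bijs_def)
    then show "(\<lambda>x. if x \<in> ?A then f x else x) \<in> {p. p permutes ?A}"
      by (auto intro!: bij_imp_permutes)
    show "wt ?A (\<lambda>x. if x \<in> ?A then f x else x) $ r = wt ?A f $ r"
      by (rule arg_cong[where f = "\<lambda>w. w $ r"], rule wt_cong) auto
  next
    fix p assume p: "p \<in> {p. p permutes ?A}"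
    then show "(\<lambda>x. if x \<in> ?A then restrict p ?A x else x) = p"
      by (auto simp: fun_eq_iff permutes_def)
    show "restrict p ?A \<in> bijs ?A ?A"
      using p permutes_imp_bij[of p ?A] bij_betw_cong[of ?A "restrict p ?A" p ?A]
      by (simp add: bijs_def)
  qed
  also have "\<dots> = (\<Sum>p | p permutes ?A. if occ132 n p = r then of_int (sgn_perm n p) else 0)"
  proof (rule sum.cong)
    fix p
    have "occs ?A p = {(i, j, k). 1 \<le> i \<and> i < j \<and> j < k \<and> k \<le> n \<and> p i < p k \<and> p k < p j}"
      by (auto simp: occs_def)
    moreover have "invs ?A p = {(i, j). 1 \<le> i \<and> i < j \<and> j \<le> n \<and> p i > p j}"
      by (auto simp: invs_def)
    moreover have "((- 1) ^ a * fps_X ^ b) $ r = (if b = r then of_int ((- 1) ^ a) else (0 :: rat))" for a b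
      using fps_mult_fps_X_power_nonzero
      by (cases "even a") auto
    ultimately show "wt ?A p $ r = (if occ132 n p = r then of_int (sgn_perm n p) else 0)"
      by (simp add: wt_def occ132_def sgn_perm_def inversions_def)
  qed simp
  also have "\<dots> = (\<Sum>p | p permutes ?A \<and> occ132 n p = r. of_int (sgn_perm n p))"
    by (subst sum.inter_filter[symmetric]) (auto simp: finite_permutations)
  finally show ?thesis by (simp add: M_def)
qed

section \<open>Inflations\<close>

text \<open>\<open>l\<close> cuts the positions and \<open>l'\<close> the values into consecutive
  intervals; interval \<open>i\<close> of positions is meant to be mapped onto interval
  \<open>\<tau> i\<close> of values. Intervals may be empty, as they can be in the inflations of 231
  below.\<close>

locale block_labels =
  fixes n m :: nat and \<tau> l l' \<nu> :: "nat \<Rightarrow> nat"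
  assumes tau: "bij_betw \<tau> {..<m} {..<m}"
    and mono_l: "\<And>x y. x \<le> y \<Longrightarrow> y < n \<Longrightarrow> l x \<le> l y"
    and mono_l': "\<And>x y. x \<le> y \<Longrightarrow> y < n \<Longrightarrow> l' x \<le> l' y"
    and l_less: "\<And>x. x < n \<Longrightarrow> l x < m"
    and l'_less: "\<And>x. x < n \<Longrightarrow> l' x < m"
    and card_l: "\<And>i. i < m \<Longrightarrow> card {x \<in> {..<n}. l x = i} = \<nu> i"
    and card_l': "\<And>i. i < m \<Longrightarrow> card {y \<in> {..<n}. l' y = \<tau> i} = \<nu> i"
begin

definition inflations :: "(nat \<Rightarrow> nat) set" where
  "inflations = {f \<in> bijs {..<n} {..<n}. \<forall>x<n. l' (f x) = \<tau> (l x)}"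

definition block :: "nat \<Rightarrow> nat set" where
  "block i = {x \<in> {..<n}. l x = i}"

definition val_block :: "nat \<Rightarrow> nat set" where
  "val_block i = {y \<in> {..<n}. l' y = \<tau> i}"

lemma finite_blocks [simp]: "finite (block i)" "finite (val_block i)"
  by (auto simp: block_def val_block_def)

lemma card_blocks: "i < m \<Longrightarrow> card (block i) = \<nu> i" "i < m \<Longrightarrow> card (val_block i) = \<nu> i"
  by (simp_all only: block_def val_block_def card_l card_l')

lemma tau_eq_iff: "i < m \<Longrightarrow> j < m \<Longrightarrow> \<tau> i = \<tau> j \<longleftrightarrow> i = j"
  using tau by (auto simp: bij_betw_def inj_on_def)

lemma less_of_label: "l x < l y \<Longrightarrow> x < n \<Longrightarrow> y < n \<Longrightarrow> x < y"
  using mono_l[of y x] by (meson leD not_le_imp_less)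

lemma less_of_label': "l' x < l' y \<Longrightarrow> x < n \<Longrightarrow> y < n \<Longrightarrow> x < y"
  using mono_l'[of y x] by (meson leD not_le_imp_less)

context
  fixes f assumes f: "f \<in> inflations"
begin

lemma inflation_less: "x < n \<Longrightarrow> f x < n"
  using f by (auto simp: inflations_def bijs_def bij_betw_def)

lemma inflation_label: "x < n \<Longrightarrow> l' (f x) = \<tau> (l x)"
  using f by (auto simp: inflations_def)

lemma inflation_less_of_label: "\<tau> (l x) < \<tau> (l y) \<Longrightarrow> x < n \<Longrightarrow> y < n \<Longrightarrow> f x < f y"
  using less_of_label'[of "f x" "f y"] by (simp add: inflation_label inflation_less)

lemma tau_le_of_f_le: "f x \<le> f y \<Longrightarrow> x < n \<Longrightarrow> y < n \<Longrightarrow> \<tau> (l x) \<le> \<tau> (l y)"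
  using mono_l'[of "f x" "f y"] by (simp add: inflation_label inflation_less)

text \<open>For points of different blocks both comparisons are decided by the labels, so an
  inversion lies inside one block or projects to an inversion of \<open>\<tau>\<close>, and every
  pair of points over an inversion of \<open>\<tau>\<close> is one.\<close>

lemma invs_inflation:
  "invs {..<n} f = (\<Union>i<m. invs (block i) f) \<union> (\<Union>(i, j)\<in>invs {..<m} \<tau>. block i \<times> block j)"
proof (intro equalityI subsetI)
  fix t assume "t \<in> invs {..<n} f"
  then obtain x y where t: "t = (x, y)" "x < n" "y < n" "x < y" "f y < f x"
    by (auto simp: invs_def)
  have "l x \<le> l y" "\<tau> (l y) \<le> \<tau> (l x)"
    using t mono_l[of x y] tau_le_of_f_le[of y x] by auto
  then have "l x = l y \<or> (l x, l y) \<in> invs {..<m} \<tau>"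
    using l_less t tau_eq_iff[of "l x" "l y"] by (auto simp: invs_def)
  then show "t \<in> (\<Union>i<m. invs (block i) f) \<union> (\<Union>(i, j)\<in>invs {..<m} \<tau>. block i \<times> block j)"
    using t l_less by (auto simp: invs_def block_def)
next
  fix t assume "t \<in> (\<Union>i<m. invs (block i) f) \<union> (\<Union>(i, j)\<in>invs {..<m} \<tau>. block i \<times> block j)"
  then show "t \<in> invs {..<n} f"
    using less_of_label inflation_less_of_label by (fastforce simp: invs_def block_def)
qed

lemma card_invs_inflation:
  "card (invs {..<n} f) =
    (\<Sum>i<m. card (invs (block i) f)) + (\<Sum>(i, j)\<in>invs {..<m} \<tau>. \<nu> i * \<nu> j)"
proof -
  have "card (\<Union>i<m. invs (block i) f) = (\<Sum>i<m. card (invs (block i) f))"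
    by (intro card_UN_disjoint) (simp_all, auto simp: invs_def block_def)
  moreover have "card (\<Union>(i, j)\<in>invs {..<m} \<tau>. block i \<times> block j) =
      (\<Sum>p\<in>invs {..<m} \<tau>. card (case p of (i, j) \<Rightarrow> block i \<times> block j))"
    by (intro card_UN_disjoint) (auto simp: block_def)
  moreover have "\<dots> = (\<Sum>(i, j)\<in>invs {..<m} \<tau>. \<nu> i * \<nu> j)"
    by (intro sum.cong) (auto simp: card_cartesian_product card_blocks invs_def)
  moreover have "(\<Union>i<m. invs (block i) f) \<inter> (\<Union>(i, j)\<in>invs {..<m} \<tau>. block i \<times> block j) = {}"
    by (auto simp: invs_def block_def)
  moreover have "finite (\<Union>(i, j)\<in>invs {..<m} \<tau>. block i \<times> block j)"
    by (intro finite_UN_I) auto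
  ultimately show ?thesis
    unfolding invs_inflation by (subst card_Un_disjoint) auto
qed

end

lemma restrict_block_bij: "f \<in> inflations \<Longrightarrow> restrict f (block i) \<in> bijs (block i) (val_block i)" if "i < m"
proof -
  assume f: "f \<in> inflations"
  have inj: "inj_on f {..<n}" and im: "f ` {..<n} = {..<n}"
    using f by (auto simp: inflations_def bijs_def bij_betw_def)
  have "f ` block i = val_block i"
  proof
    show "f ` block i \<subseteq> val_block i"
      using inflation_label[OF f] inflation_less[OF f] by (auto simp: block_def val_block_def)
    show "val_block i \<subseteq> f ` block i"
    proof
      fix y assume y: "y \<in> val_block i"
      then have "y \<in> f ` {..<n}" by (simp add: val_block_def im)
      then obtain x where "x < n" "y = f x" by auto
      then show "y \<in> f ` block i"
        using y inflation_label[OF f, of x] tau_eq_iff[OF l_less[of x] that]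
        by (auto simp: block_def val_block_def)
    qed
  qed
  moreover have "inj_on f (block i)"
    using inj by (rule inj_on_subset) (auto simp: block_def)
  ultimately show ?thesis by (auto simp: bijs_def bij_betw_def)
qed

lemma glue_inflation:
  assumes "g \<in> (\<Pi>\<^sub>E i\<in>{..<m}. bijs (block i) (val_block i))"
  shows "(\<lambda>x\<in>{..<n}. g (l x) x) \<in> inflations"
proof -
  let ?f = "\<lambda>x\<in>{..<n}. g (l x) x"
  have g: "bij_betw (g i) (block i) (val_block i)" if "i < m" for i
    using assms that by (auto simp: PiE_def Pi_def bijs_def)
  have gx: "g (l x) x \<in> val_block (l x)" if "x < n" for x
    using g[OF l_less[OF that]] that by (auto simp: bij_betw_def block_def)
  have "inj_on ?f {..<n}"
  proof (rule inj_onI)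
    fix x y assume *: "x \<in> {..<n}" "y \<in> {..<n}" "?f x = ?f y"
    then have "\<tau> (l x) = \<tau> (l y)" using gx[of x] gx[of y] by (auto simp: val_block_def)
    then have "l x = l y" using * tau_eq_iff[OF l_less l_less] by auto
    then show "x = y"
      using * g[OF l_less[of x]] by (auto simp: bij_betw_def inj_on_def block_def)
  qed
  moreover have "?f ` {..<n} \<subseteq> {..<n}" using gx by (auto simp: val_block_def)
  ultimately have "bij_betw ?f {..<n} {..<n}"
    by (simp add: bij_betw_def endo_inj_surj)
  then show ?thesis using gx by (auto simp: inflations_def bijs_def val_block_def)
qed

text \<open>An inflation amounts to an independent choice of a bijection for each block, so the sum
  of products is a product of sums.\<close>

lemma sum_prod_blocks:
  "(\<Sum>f\<in>inflations. \<Prod>i<m. wt (block i) f) = (\<Prod>i<m. perm_sum (\<nu> i))"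
proof -
  have "(\<Sum>f\<in>inflations. \<Prod>i<m. wt (block i) f) =
      (\<Sum>g\<in>(\<Pi>\<^sub>E i\<in>{..<m}. bijs (block i) (val_block i)). \<Prod>i<m. wt (block i) (g i))"
  proof (rule sum.reindex_bij_witness[where i = "\<lambda>g. \<lambda>x\<in>{..<n}. g (l x) x"
        and j = "\<lambda>f. \<lambda>i\<in>{..<m}. restrict f (block i)"])
    fix f assume f: "f \<in> inflations"
    then show "(\<lambda>x\<in>{..<n}. (\<lambda>i\<in>{..<m}. restrict f (block i)) (l x) x) = f"
      by (auto simp: inflations_def bijs_def extensional_def block_def l_less fun_eq_iff)
    show "(\<lambda>i\<in>{..<m}. restrict f (block i)) \<in> (\<Pi>\<^sub>E i\<in>{..<m}. bijs (block i) (val_block i))"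
      using restrict_block_bij f by auto
    show "(\<Prod>i<m. wt (block i) ((\<lambda>i\<in>{..<m}. restrict f (block i)) i)) = (\<Prod>i<m. wt (block i) f)"
      by (intro prod.cong refl) (auto intro: wt_cong)
  next
    fix g assume g: "g \<in> (\<Pi>\<^sub>E i\<in>{..<m}. bijs (block i) (val_block i))"
    show "(\<lambda>x\<in>{..<n}. g (l x) x) \<in> inflations" using glue_inflation[OF g] .
    have "restrict (\<lambda>x\<in>{..<n}. g (l x) x) (block i) = g i" if "i < m" for i
    proof -
      have "g i \<in> extensional (block i)" using g that by (auto simp: PiE_def Pi_def bijs_def)
      then show ?thesis by (auto simp: block_def extensional_def fun_eq_iff)
    qed
    moreover have "g \<in> extensional {..<m}" using g by (auto simp: PiE_def)
    ultimately show "(\<lambda>i\<in>{..<m}. restrict (\<lambda>x\<in>{..<n}. g (l x) x) (block i)) = g"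
      by (auto simp: fun_eq_iff extensional_def)
  qed
  also have "\<dots> = (\<Prod>i<m. \<Sum>f\<in>bijs (block i) (val_block i). wt (block i) f)"
    by (subst prod_sum_PiE) auto
  also have "\<dots> = (\<Prod>i<m. perm_sum (\<nu> i))"
    by (intro prod.cong refl sum_wt_bijs) (simp_all add: card_blocks)
  finally show ?thesis .
qed

end

text \<open>A point to the lower left of a block and a descent inside that block would form an
  occurrence spread over two blocks; \<open>inc_size\<close> excludes this. \<open>occ_size\<close>
  makes every occurrence of \<open>\<tau>\<close> lift to exactly one occurrence of the
  inflation.\<close>

locale rigid_labels = block_labels +
  assumes inc_size: "\<And>i j. i < j \<Longrightarrow> j < m \<Longrightarrow> \<tau> i < \<tau> j \<Longrightarrow> \<nu> j \<le> 1"
    and occ_size: "\<And>i j k. (i, j, k) \<in> occs {..<m} \<tau> \<Longrightarrow> \<nu> i = 1 \<and> \<nu> j = 1 \<and> \<nu> k = 1"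
begin

lemma block_eqI:
  assumes "x < n" "y < n" "l x = l y" "\<nu> (l x) \<le> 1"
  shows "x = y"
proof -
  have "card (block (l x)) \<le> 1" using assms l_less by (simp add: card_blocks)
  then show ?thesis using assms card_le_Suc0_iff_eq[of "block (l x)"]
    by (auto simp: block_def)
qed

text \<open>Position labels increase weakly along x, y, z and value labels along x, z, y. If
  \<open>l x\<close> equals another label, the remaining one is squeezed in and all agree;
  \<open>l y = l z\<close> alone would put two points into a block that \<open>inc_size\<close>
  makes at most a singleton.\<close>

lemma occ_label_cases:
  assumes "f \<in> inflations" "(x, y, z) \<in> occs {..<n} f"
  shows "(l x = l y \<and> l z = l y) \<or> (l x, l y, l z) \<in> occs {..<m} \<tau>"
proof -
  have t: "x < n" "y < n" "z < n" "x < y" "y < z" "f x < f z" "f z < f y"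
    using assms(2) by (auto simp: occs_def)
  note m = l_less[OF t(1)] l_less[OF t(2)] l_less[OF t(3)]
  have le: "l x \<le> l y" "l y \<le> l z" "\<tau> (l x) \<le> \<tau> (l z)" "\<tau> (l z) \<le> \<tau> (l y)"
    using t mono_l[of x y] mono_l[of y z] tau_le_of_f_le[OF assms(1), of x z]
      tau_le_of_f_le[OF assms(1), of z y] by auto
  show ?thesis
  proof (cases "l y = l z")
    case True
    show ?thesis
    proof (cases "l x = l y")
      case False
      then have "\<nu> (l y) \<le> 1"
        using True le m tau_eq_iff[of "l x" "l y"] by (intro inc_size[of "l x"]) auto
      then have "y = z" using block_eqI[of y z] t True by simp
      then show ?thesis using t by simp
    qed (use True in simp)
  next
    case False
    then have "\<tau> (l z) < \<tau> (l y)" using le m tau_eq_iff[of "l y" "l z"] by auto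
    moreover have "\<tau> (l x) < \<tau> (l z)" using False le m tau_eq_iff[of "l x" "l z"] by auto
    ultimately show ?thesis using False le m by (force simp: occs_def)
  qed
qed

lemma card_occs_inflation:
  assumes f: "f \<in> inflations"
  shows "card (occs {..<n} f) = (\<Sum>i<m. card (occs (block i) f)) + card (occs {..<m} \<tau>)"
proof -
  \<comment> \<open>\<open>T\<close> collects the occurrences that spread over three blocks. These
    blocks are singletons by \<open>occ_size\<close>, so passing to labels is a bijection onto the
    occurrences of \<open>\<tau>\<close>.\<close>
  define T where "T = {(x, y, z) \<in> occs {..<n} f. (l x, l y, l z) \<in> occs {..<m} \<tau>}"
  have fT: "finite T" by (rule finite_subset[of _ "occs {..<n} f"]) (auto simp: T_def)
  have "occs {..<n} f = (\<Union>i<m. occs (block i) f) \<union> T"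
  proof (intro equalityI subsetI)
    fix t assume "t \<in> occs {..<n} f"
    moreover obtain x y z where "t = (x, y, z)" by (cases t)
    ultimately show "t \<in> (\<Union>i<m. occs (block i) f) \<union> T"
      using occ_label_cases[OF f, of x y z] l_less by (auto simp: T_def occs_def block_def)
  qed (auto simp: T_def occs_def block_def)
  moreover have "(\<Union>i<m. occs (block i) f) \<inter> T = {}"
    by (auto simp: T_def occs_def block_def)
  moreover have "card (\<Union>i<m. occs (block i) f) = (\<Sum>i<m. card (occs (block i) f))"
    by (intro card_UN_disjoint) (simp_all, auto simp: occs_def block_def)
  moreover have "card T = card (occs {..<m} \<tau>)"
  proof (rule bij_betw_same_card)
    show "bij_betw (\<lambda>(x, y, z). (l x, l y, l z)) T (occs {..<m} \<tau>)"
      unfolding bij_betw_def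
    proof
      show "inj_on (\<lambda>(x, y, z). (l x, l y, l z)) T"
      proof (rule inj_onI)
        fix s t assume st: "s \<in> T" "t \<in> T"
          "(case s of (x, y, z) \<Rightarrow> (l x, l y, l z)) = (case t of (x, y, z) \<Rightarrow> (l x, l y, l z))"
        obtain x y z x' y' z' where eq: "s = (x, y, z)" "t = (x', y', z')" by (cases s, cases t)
        then have "\<nu> (l x) = 1" "\<nu> (l y) = 1" "\<nu> (l z) = 1"
          using st(1) occ_size by (auto simp: T_def)
        then show "s = t"
          using st eq block_eqI[of x x'] block_eqI[of y y'] block_eqI[of z z']
          by (auto simp: T_def occs_def)
      qed
      show "(\<lambda>(x, y, z). (l x, l y, l z)) ` T = occs {..<m} \<tau>"
      proof (intro equalityI subsetI)
        fix t assume t: "t \<in> occs {..<m} \<tau>"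
        obtain i j k where ijk: "t = (i, j, k)" by (cases t)
        have "\<nu> i = 1" "\<nu> j = 1" "\<nu> k = 1" "i < m" "j < m" "k < m"
          using t ijk occ_size by (auto simp: occs_def)
        then have "block i \<noteq> {}" "block j \<noteq> {}" "block k \<noteq> {}"
          using card_blocks(1) by (metis card.empty zero_neq_one)+
        then obtain x y z where xyz: "x < n" "l x = i" "y < n" "l y = j" "z < n" "l z = k"
          by (auto simp: block_def)
        then have "x < y" "y < z" "f x < f z" "f z < f y"
          using t ijk less_of_label inflation_less_of_label[OF f] by (auto simp: occs_def)
        then have "(x, y, z) \<in> T" using t ijk xyz by (auto simp: T_def occs_def)
        then show "t \<in> (\<lambda>(x, y, z). (l x, l y, l z)) ` T"
          using xyz ijk by force
      qed (auto simp: T_def)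
    qed
  qed
  ultimately show ?thesis using fT by (subst \<open>occs {..<n} f = _\<close>, subst card_Un_disjoint) auto
qed

theorem sum_wt_inflations:
  "(\<Sum>f\<in>inflations. wt {..<n} f) =
    (- 1) ^ (\<Sum>(i, j)\<in>invs {..<m} \<tau>. \<nu> i * \<nu> j) * fps_X ^ card (occs {..<m} \<tau>) *
    (\<Prod>i<m. perm_sum (\<nu> i))"
proof -
  have "wt {..<n} f = (- 1) ^ (\<Sum>(i, j)\<in>invs {..<m} \<tau>. \<nu> i * \<nu> j) * fps_X ^ card (occs {..<m} \<tau>) *
      (\<Prod>i<m. wt (block i) f)" if "f \<in> inflations" for f
    unfolding wt_def card_invs_inflation[OF that] card_occs_inflation[OF that] prod.distrib
    by (simp add: power_add power_sum mult_ac)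
  then show ?thesis by (simp add: sum_prod_blocks sum_distrib_left[symmetric])
qed

end

section \<open>The kernel of a permutation\<close>

text \<open>The closed subsets of \<open>{..<n}\<close> are the unions of connected components of
  the hypergraph of occurrences, so the kernel can be defined as an intersection, without
  paths.\<close>

definition occ_closed :: "nat \<Rightarrow> (nat \<Rightarrow> nat) \<Rightarrow> nat set \<Rightarrow> bool" where
  "occ_closed n f C \<longleftrightarrow>
    (\<forall>i j k. (i, j, k) \<in> occs {..<n} f \<longrightarrow> i \<in> C \<or> j \<in> C \<or> k \<in> C \<longrightarrow> i \<in> C \<and> j \<in> C \<and> k \<in> C)"

text \<open>A set rather than a position, so that the empty permutation is covered and nothing is
  chosen; \<open>Suc\<close> avoids truncated subtraction.\<close>

definition max_pos :: "nat \<Rightarrow> (nat \<Rightarrow> nat) \<Rightarrow> nat set" where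
  "max_pos n f = {i. i < n \<and> Suc (f i) = n}"

definition kernel :: "nat \<Rightarrow> (nat \<Rightarrow> nat) \<Rightarrow> nat set" where
  "kernel n f = \<Inter>{C. C \<subseteq> {..<n} \<and> occ_closed n f C \<and> max_pos n f \<subseteq> C}"

text \<open>Rows and columns through the kernel points cut the plane into cells. The disjunct
  \<open>x = y\<close> makes each kernel point a class of its own.\<close>

definition same_cell :: "nat \<Rightarrow> (nat \<Rightarrow> nat) \<Rightarrow> nat \<Rightarrow> nat \<Rightarrow> bool" where
  "same_cell n f x y \<longleftrightarrow> x = y \<or> x \<notin> kernel n f \<and> y \<notin> kernel n f \<and>
    (\<forall>a\<in>kernel n f. (a < x \<longleftrightarrow> a < y) \<and> (f a < f x \<longleftrightarrow> f a < f y))"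

definition reduced :: "nat \<Rightarrow> (nat \<Rightarrow> nat) \<Rightarrow> bool" where
  "reduced n f \<longleftrightarrow> (\<forall>x<n. \<forall>y<n. same_cell n f x y \<longrightarrow> x = y)"

lemma occ_closedD:
  assumes "occ_closed n f C" "(i, j, k) \<in> occs {..<n} f" "i \<in> C \<or> j \<in> C \<or> k \<in> C"
  shows "i \<in> C" "j \<in> C" "k \<in> C"
  using assms unfolding occ_closed_def by metis+

lemma kernel_least: "C \<subseteq> {..<n} \<Longrightarrow> occ_closed n f C \<Longrightarrow> max_pos n f \<subseteq> C \<Longrightarrow> kernel n f \<subseteq> C"
  by (auto simp: kernel_def)

lemma kernel_subset: "kernel n f \<subseteq> {..<n}"
  by (rule kernel_least) (auto simp: occ_closed_def occs_def max_pos_def)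

lemma kernel_less: "x \<in> kernel n f \<Longrightarrow> x < n"
  using kernel_subset by blast

lemma max_pos_less: "x \<in> max_pos n f \<Longrightarrow> x < n"
  by (simp add: max_pos_def)

lemma max_pos_in_kernel: "max_pos n f \<subseteq> kernel n f"
  by (auto simp: kernel_def)

lemma occ_closed_kernel: "occ_closed n f (kernel n f)"
  unfolding occ_closed_def kernel_def by blast

lemma kernel_occ:
  assumes "(i, j, k) \<in> occs {..<n} f" "i \<in> kernel n f \<or> j \<in> kernel n f \<or> k \<in> kernel n f"
  shows "i \<in> kernel n f" "j \<in> kernel n f" "k \<in> kernel n f"
  using occ_closedD[OF occ_closed_kernel assms] .

context
  fixes n f assumes f: "f \<in> bijs {..<n} {..<n}"
begin

lemma bijs_eq_iff: "x < n \<Longrightarrow> y < n \<Longrightarrow> f x = f y \<longleftrightarrow> x = y"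
  using f by (auto simp: bijs_def bij_betw_def inj_on_def)

lemma bijs_less: "x < n \<Longrightarrow> f x < n"
  using f by (auto simp: bijs_def bij_betw_def)

lemma ex_max_pos: "n > 0 \<Longrightarrow> \<exists>p<n. max_pos n f = {p}"
proof -
  assume "n > 0"
  then have "n - 1 \<in> f ` {..<n}" using f by (auto simp: bijs_def bij_betw_def)
  then obtain p where "p < n" "f p = n - 1" by auto
  then show ?thesis using bijs_eq_iff \<open>n > 0\<close>
    by (intro exI[of _ p]) (auto simp: max_pos_def)
qed

text \<open>The part of the kernel to the lower left of a point outside the kernel is a union of
  components that misses the maximum, hence empty.\<close>

lemma kernel_not_below_left:
  assumes p: "p < n" "p \<notin> kernel n f" and q: "q \<in> kernel n f" "q < p"
  shows "f p < f q"
proof (rule ccontr)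
  let ?K = "kernel n f"
  assume "\<not> f p < f q"
  then have fq: "f q < f p" using bijs_eq_iff[of p q] p q kernel_less[of q n f] by fastforce
  define SW where "SW = {a \<in> ?K. a < p \<and> f a < f p}"
  \<comment> \<open>\<open>p\<close> forms no occurrence with two kernel points: \<open>N1\<close>,
    \<open>N2\<close> and \<open>N3\<close> exclude it as the smallest, the largest and the last
    point, respectively.\<close>
  have N1: "\<not> (p < a \<and> a < b \<and> f p < f b \<and> f b < f a)" if "a \<in> ?K" "b \<in> ?K" for a b
    using kernel_occ[of p a b n f] that p kernel_less by (fastforce simp: occs_def)
  have N2: "\<not> (a < p \<and> p < b \<and> f a < f b \<and> f b < f p)" if "a \<in> ?K" "b \<in> ?K" for a b
    using kernel_occ[of a p b n f] that p kernel_less by (fastforce simp: occs_def)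
  have N3: "\<not> (a < b \<and> b < p \<and> f a < f p \<and> f p < f b)" if "a \<in> ?K" "b \<in> ?K" for a b
    using kernel_occ[of a b p n f] that p kernel_less by (fastforce simp: occs_def)
  have ne: "a \<noteq> p \<and> f a \<noteq> f p" if "a \<in> ?K" for a
    using that p bijs_eq_iff kernel_less by blast
  have "occ_closed n f (?K - SW)"
    unfolding occ_closed_def
  proof (intro allI impI)
    fix i j k assume o: "(i, j, k) \<in> occs {..<n} f" and "i \<in> ?K - SW \<or> j \<in> ?K - SW \<or> k \<in> ?K - SW"
    then have K: "i \<in> ?K" "j \<in> ?K" "k \<in> ?K" using kernel_occ[OF o] by auto
    have r: "i < j" "j < k" "f i < f k" "f k < f j" using o by (auto simp: occs_def)
    note N = N1[of j k] N2[of i k] N2[of i j] N3[of i j]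
    \<comment> \<open>If \<open>j\<close> were right of \<open>p\<close>, then p, j, k or i, p, k
      would be an occurrence, according to whether \<open>k\<close> lies above or below
      \<open>p\<close>; if \<open>j\<close> were left of and above \<open>p\<close>, then i, j, p
      would be one. So \<open>k\<close> is below \<open>p\<close> too, and to the right of
      \<open>p\<close> it would complete i, p, k.\<close>
    have i: "j \<in> SW \<and> k \<in> SW" if "i \<in> SW"
    proof -
      have i: "i < p" "f i < f p" using that by (auto simp: SW_def)
      have j: "j < p" "f j < f p"
        using i r K N ne[of j] ne[of k] by linarith+
      then show ?thesis using i r K N ne[of k] by (auto simp: SW_def)
    qed
    \<comment> \<open>The first point of an occurrence is to the lower left of the other
      two.\<close>
    have "i \<in> SW" if "j \<in> SW \<or> k \<in> SW" using that r K by (auto simp: SW_def)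
    then show "i \<in> ?K - SW \<and> j \<in> ?K - SW \<and> k \<in> ?K - SW"
      using i K \<open>i \<in> ?K - SW \<or> j \<in> ?K - SW \<or> k \<in> ?K - SW\<close> by blast
  qed
  moreover have "max_pos n f \<inter> SW = {}"
    using bijs_less[OF p(1)] by (auto simp: SW_def max_pos_def)
  moreover have "?K - SW \<subseteq> {..<n}" using kernel_subset by blast
  moreover have "max_pos n f \<subseteq> ?K" by (rule max_pos_in_kernel)
  ultimately have "?K \<subseteq> ?K - SW" by (intro kernel_least) blast+
  then show False using q fq by (auto simp: SW_def)
qed

text \<open>By \<open>kernel_not_below_left\<close> a kernel point strictly between in position lies
  above \<open>q\<close>, and one strictly between in value lies to the right of \<open>q\<close>.
  Either way it forms an occurrence with \<open>p\<close> and \<open>q\<close>, which would pull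
  both into the kernel.\<close>

lemma increasing_same_cell:
  assumes "p < q" "q < n" "f p < f q" "p \<notin> kernel n f" "q \<notin> kernel n f"
  shows "same_cell n f p q"
proof -
  have "(a < p \<longleftrightarrow> a < q) \<and> (f a < f p \<longleftrightarrow> f a < f q)" if a: "a \<in> kernel n f" for a
  proof -
    have an: "a < n" using a kernel_less by blast
    have "a \<noteq> p" "a \<noteq> q" "f a \<noteq> f p" "f a \<noteq> f q"
      using a assms bijs_eq_iff an by auto
    moreover have "\<not> (p < a \<and> a < q)"
      using kernel_not_below_left[of q a] kernel_occ[of p a q n f] a an assms by (auto simp: occs_def)
    moreover have "\<not> (f p < f a \<and> f a < f q)"
      using kernel_not_below_left[of q a] kernel_occ[of p q a n f] a an assms nat_neq_iff[of a q]
      by (auto simp: occs_def)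
    ultimately show ?thesis using assms by linarith
  qed
  then show ?thesis using assms by (auto simp: same_cell_def)
qed

lemma same_cell_refl: "same_cell n f x x"
  by (simp add: same_cell_def)

lemma same_cell_sym: "same_cell n f x y \<Longrightarrow> same_cell n f y x"
  by (auto simp: same_cell_def)

lemma same_cell_trans: "same_cell n f x y \<Longrightarrow> same_cell n f y z \<Longrightarrow> same_cell n f x z"
  by (auto simp: same_cell_def)

text \<open>Cells are intervals of positions and of values. Betweenness in one coordinate suffices:
  either \<open>q\<close> forms an increasing pair with \<open>p\<close> or \<open>t\<close> and
  shares its cell, or it lies between them in both coordinates and compares with every kernel point
  as they do.\<close>

lemma same_cell_convex:
  assumes "p < n" "q < n" "t < n" and pt: "same_cell n f p t"
    and between: "p \<le> q \<and> q \<le> t \<or> f p \<le> f q \<and> f q \<le> f t"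
  shows "same_cell n f p q"
proof (cases "q = p \<or> q = t")
  case True
  then show ?thesis using pt same_cell_refl by auto
next
  case False
  then have ne: "q \<noteq> p" "q \<noteq> t" "f q \<noteq> f p" "f q \<noteq> f t" using assms bijs_eq_iff by auto
  have "p \<noteq> t" using between ne by auto
  then have nK: "p \<notin> kernel n f" "t \<notin> kernel n f"
    and cell: "\<And>a. a \<in> kernel n f \<Longrightarrow> (a < p \<longleftrightarrow> a < t) \<and> (f a < f p \<longleftrightarrow> f a < f t)"
    using pt by (auto simp: same_cell_def)
  have q: "q \<notin> kernel n f" using cell[of q] between ne by (force simp: le_less)
  have "p < q \<and> q < t \<or> f p < f q \<and> f q < f t" using between ne by (simp add: le_less)
  moreover have "p < q \<or> q < p" "q < t \<or> t < q" "f p < f q \<or> f q < f p" "f q < f t \<or> f t < f q"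
    using ne by auto
  ultimately consider "p < q \<and> f p < f q" | "q < p \<and> f q < f p" | "q < t \<and> f q < f t" | "t < q \<and> f t < f q"
    | "p < q \<and> q < t \<and> f t < f q \<and> f q < f p" | "t < q \<and> q < p \<and> f p < f q \<and> f q < f t"
    by blast
  then show ?thesis
  proof cases
    case 1 then show ?thesis using increasing_same_cell q nK assms by blast
  next
    case 2 then show ?thesis using increasing_same_cell same_cell_sym q nK assms by blast
  next
    case 3 then show ?thesis using increasing_same_cell same_cell_sym same_cell_trans q nK assms by blast
  next
    case 4 then show ?thesis using increasing_same_cell same_cell_sym same_cell_trans q nK assms by blast
  next
    case 5
    have "(a < p \<longleftrightarrow> a < q) \<and> (f a < f p \<longleftrightarrow> f a < f q)" if "a \<in> kernel n f" for a
      using cell[OF that] 5 by (metis less_trans)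
    then show ?thesis using nK q by (simp add: same_cell_def)
  next
    case 6
    have "(a < p \<longleftrightarrow> a < q) \<and> (f a < f p \<longleftrightarrow> f a < f q)" if "a \<in> kernel n f" for a
      using cell[OF that] 6 by (metis less_trans)
    then show ?thesis using nK q by (simp add: same_cell_def)
  qed
qed

lemma kernel_no_occs: "occs {..<n} f = {} \<Longrightarrow> kernel n f = max_pos n f"
  by (intro equalityI max_pos_in_kernel kernel_least) (auto simp: occ_closed_def max_pos_def)

text \<open>The maximum together with all points on occurrences is a closed set, and each occurrence
  supplies at most three points.\<close>

lemma card_kernel_le:
  assumes "n > 0"
  shows "card (kernel n f) \<le> 1 + 3 * card (occs {..<n} f)"
proof -
  let ?O = "occs {..<n} f"
  let ?C = "max_pos n f \<union> (\<Union>(i, j, k)\<in>?O. {i, j, k})"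
  obtain p where p: "p < n" "max_pos n f = {p}" using ex_max_pos assms by blast
  have "kernel n f \<subseteq> ?C"
  proof (rule kernel_least)
    show "?C \<subseteq> {..<n}" by (auto simp: max_pos_def occs_def)
    show "occ_closed n f ?C" unfolding occ_closed_def by blast
  qed auto
  moreover have fin: "finite (\<Union>(i, j, k)\<in>?O. {i, j, k})" by (intro finite_UN_I) auto
  ultimately have "card (kernel n f) \<le> card ?C" using p by (intro card_mono) auto
  also have "\<dots> \<le> 1 + card (\<Union>(i, j, k)\<in>?O. {i, j, k})"
    using p fin by (simp add: card_insert_if)
  also have "card (\<Union>(i, j, k)\<in>?O. {i, j, k}) \<le> (\<Sum>(i, j, k)\<in>?O. card {i, j, k})"
    using card_UN_le[of ?O "\<lambda>(i, j, k). {i, j, k}"] by (simp add: case_prod_unfold)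
  also have "\<dots> \<le> (\<Sum>t\<in>?O. 3)"
    by (intro sum_mono) (auto simp: card_insert_if)
  finally show ?thesis by simp
qed

text \<open>A point outside the kernel is determined by two subsets of the kernel, the points to its
  left and the points below it, which gives 2^k * 2^k possibilities for a kernel of size k.\<close>

lemma reduced_size_le:
  assumes "reduced n f"
  shows "n \<le> card (kernel n f) + 4 ^ card (kernel n f)"
proof -
  let ?K = "kernel n f"
  have fin: "finite ?K" using kernel_subset finite_subset by blast
  have "card ({..<n} - ?K) \<le> card (Pow ?K \<times> Pow ?K)"
  proof (rule card_inj_on_le[where f = "\<lambda>x. ({a \<in> ?K. a < x}, {a \<in> ?K. f a < f x})"])
    show "inj_on (\<lambda>x. ({a \<in> ?K. a < x}, {a \<in> ?K. f a < f x})) ({..<n} - ?K)"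
    proof (rule inj_onI)
      fix x y assume *: "x \<in> {..<n} - ?K" "y \<in> {..<n} - ?K"
        "({a \<in> ?K. a < x}, {a \<in> ?K. f a < f x}) = ({a \<in> ?K. a < y}, {a \<in> ?K. f a < f y})"
      then have "same_cell n f x y" unfolding same_cell_def by blast
      then show "x = y" using assms * by (auto simp: reduced_def)
    qed
  qed (use fin in auto)
  also have "\<dots> = 4 ^ card ?K"
    using fin by (simp add: card_cartesian_product card_Pow flip: power_mult_distrib)
  finally have "n - card ?K \<le> 4 ^ card ?K"
    using kernel_subset[of n f] fin by (simp add: card_Diff_subset)
  then show ?thesis by linarith
qed

end

text \<open>The locale is used twice, with \<open>S\<close> the kernel of the pattern and with \<open>S\<close> the set of labels of
  the kernel of \<open>f\<close>: the former identifies the kernel of a given inflation, the latter the kernel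
  of the pattern extracted from a given permutation.\<close>

locale kernel_transfer = block_labels +
  fixes f S
  assumes f: "f \<in> inflations"
    and n_pos: "n > 0"
    and nonempty: "\<And>i. i < m \<Longrightarrow> \<nu> i > 0"
    and S: "S \<subseteq> {..<m}" "max_pos m \<tau> \<subseteq> S"
    and single: "\<And>i. i \<in> S \<Longrightarrow> \<nu> i = 1"
    and occ_cases: "\<And>x y z. (x, y, z) \<in> occs {..<n} f \<Longrightarrow>
      l x = l y \<and> l z = l y \<and> l x \<notin> S \<or> l x \<in> S \<and> l y \<in> S \<and> l z \<in> S"
begin

lemma f_bij: "f \<in> bijs {..<n} {..<n}"
  using f by (simp add: inflations_def)

lemma onto: "i < m \<Longrightarrow> \<exists>x<n. l x = i"
  using nonempty[of i] card_blocks(1)[of i] card_gt_0_iff[of "block i"] by (auto simp: block_def)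

lemma onto': "i < m \<Longrightarrow> \<exists>y<n. l' y = \<tau> i"
  using nonempty[of i] card_blocks(2)[of i] card_gt_0_iff[of "val_block i"] by (auto simp: val_block_def)

lemma S_eqI: "x < n \<Longrightarrow> y < n \<Longrightarrow> l x = l y \<Longrightarrow> l x \<in> S \<Longrightarrow> x = y"
  using card_blocks(1)[of "l x"] single[of "l x"] l_less[of x] card_le_Suc0_iff_eq[of "block (l x)"]
  by (auto simp: block_def)

lemma lift_occ:
  assumes "(i, j, k) \<in> occs {..<m} \<tau>" "x < n" "y < n" "z < n" "l x = i" "l y = j" "l z = k"
  shows "(x, y, z) \<in> occs {..<n} f"
  using assms less_of_label inflation_less_of_label[OF f] by (auto simp: occs_def)

lemma occ_preimage:
  assumes "(i, j, k) \<in> occs {..<m} \<tau>"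
  obtains x y z where "x < n" "y < n" "z < n" "l x = i" "l y = j" "l z = k"
proof -
  have "i < m" "j < m" "k < m" using assms by (auto simp: occs_def)
  then show ?thesis using onto that by meson
qed

text \<open>A lifted occurrence has three different labels, which leaves only the second alternative
  of \<open>occ_cases\<close>.\<close>

lemma occ_in_S:
  assumes "(i, j, k) \<in> occs {..<m} \<tau>"
  shows "i \<in> S" "j \<in> S" "k \<in> S"
proof -
  obtain x y z where "x < n" "y < n" "z < n" "l x = i" "l y = j" "l z = k"
    using occ_preimage[OF assms] .
  then show "i \<in> S" "j \<in> S" "k \<in> S"
    using occ_cases[OF lift_occ[OF assms]] assms by (auto simp: occs_def)
qed

lemma kernel_pattern_subset: "kernel m \<tau> \<subseteq> S"
  using S occ_in_S by (intro kernel_least) (auto simp: occ_closed_def)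

lemma max_label:
  assumes "x \<in> max_pos n f"
  shows "l x \<in> max_pos m \<tau>"
proof -
  have x: "x < n" "Suc (f x) = n" using assms by (auto simp: max_pos_def)
  have "m > 0" using l_less[OF x(1)] by simp
  have "m - 1 \<in> \<tau> ` {..<m}" using tau \<open>m > 0\<close> by (auto simp: bij_betw_def)
  then obtain i where i: "i < m" "\<tau> i = m - 1" by auto
  \<comment> \<open>The top value block is nonempty, so by monotonicity it contains the largest
    value n - 1.\<close>
  obtain y where "y < n" "l' y = m - 1" using onto'[OF i(1)] i by auto
  then have "m - 1 \<le> l' (f x)" using mono_l'[of y "f x"] x by auto
  then have "\<tau> (l x) = m - 1" using inflation_label[OF f x(1)] l'_less[of "f x"] x by auto
  then show ?thesis using l_less[OF x(1)] \<open>m > 0\<close> by (auto simp: max_pos_def)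
qed

lemma kernel_eq: "kernel n f = {x \<in> {..<n}. l x \<in> kernel m \<tau>}"
proof (intro equalityI subsetI)
  fix x assume "x \<in> kernel n f"
  also have "kernel n f \<subseteq> {x \<in> {..<n}. l x \<in> kernel m \<tau>}"
  proof (rule kernel_least)
    show "max_pos n f \<subseteq> {x \<in> {..<n}. l x \<in> kernel m \<tau>}"
      using max_label max_pos_in_kernel max_pos_less by blast
    show "occ_closed n f {x \<in> {..<n}. l x \<in> kernel m \<tau>}"
      unfolding occ_closed_def
    proof (intro allI impI)
      fix x y z assume o: "(x, y, z) \<in> occs {..<n} f"
        and t: "x \<in> {x \<in> {..<n}. l x \<in> kernel m \<tau>} \<or> y \<in> {x \<in> {..<n}. l x \<in> kernel m \<tau>} \<or>
          z \<in> {x \<in> {..<n}. l x \<in> kernel m \<tau>}"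
      have r: "x < n" "y < n" "z < n" "x < y" "y < z" "f x < f z" "f z < f y"
        using o by (auto simp: occs_def)
      have s: "l x \<in> S" "l y \<in> S" "l z \<in> S"
        using t occ_cases[OF o] kernel_pattern_subset by auto
      \<comment> \<open>Blocks with labels in \<open>S\<close> are singletons, so the three labels
        differ and the weak inequalities between them become strict.\<close>
      have "l x \<noteq> l y" "l y \<noteq> l z" "l x \<noteq> l z"
        using s S_eqI[of x y] S_eqI[of y z] S_eqI[of x z] r by auto
      moreover have "l x \<le> l y" "l y \<le> l z" "\<tau> (l x) \<le> \<tau> (l z)" "\<tau> (l z) \<le> \<tau> (l y)"
        using r mono_l tau_le_of_f_le[OF f] by auto
      ultimately have "(l x, l y, l z) \<in> occs {..<m} \<tau>"
        using r l_less tau_eq_iff[of "l x" "l z"] tau_eq_iff[of "l y" "l z"]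
        by (auto simp: occs_def le_less)
      then show "x \<in> {x \<in> {..<n}. l x \<in> kernel m \<tau>} \<and> y \<in> {x \<in> {..<n}. l x \<in> kernel m \<tau>} \<and>
          z \<in> {x \<in> {..<n}. l x \<in> kernel m \<tau>}"
        using kernel_occ[of "l x" "l y" "l z" m \<tau>] t r by auto
    qed
  qed auto
  finally show "x \<in> {x \<in> {..<n}. l x \<in> kernel m \<tau>}" .
next
  fix x assume x: "x \<in> {x \<in> {..<n}. l x \<in> kernel m \<tau>}"
  \<comment> \<open>The labels of kernel points form a closed set containing the label of the
    maximum, hence contain the kernel of the pattern. Inside \<open>S\<close> blocks are singletons,
    so membership in \<open>D\<close> can be pulled back to points.\<close>
  define D where "D = {i \<in> S. \<exists>x\<in>kernel n f. l x = i}"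
  have D_kernel: "a \<in> kernel n f" if a: "a < n" "l a \<in> D" for a
  proof -
    obtain b where "b \<in> kernel n f" "l b = l a" "l b \<in> S" using a by (auto simp: D_def)
    then show ?thesis using S_eqI[of b a] kernel_less[of b n f] a by auto
  qed
  have "kernel m \<tau> \<subseteq> D"
  proof (rule kernel_least)
    show "D \<subseteq> {..<m}" using S by (auto simp: D_def)
    show "occ_closed m \<tau> D"
      unfolding occ_closed_def
    proof (intro allI impI)
      fix i j k assume o: "(i, j, k) \<in> occs {..<m} \<tau>" and t: "i \<in> D \<or> j \<in> D \<or> k \<in> D"
      obtain x y z where xyz: "x < n" "y < n" "z < n" "l x = i" "l y = j" "l z = k"
        using occ_preimage[OF o] .
      have s: "l x \<in> S" "l y \<in> S" "l z \<in> S" using occ_in_S[OF o] xyz by auto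
      have "x \<in> kernel n f \<or> y \<in> kernel n f \<or> z \<in> kernel n f"
        using t D_kernel xyz by blast
      then have "x \<in> kernel n f" "y \<in> kernel n f" "z \<in> kernel n f"
        by (rule kernel_occ[OF lift_occ[OF o xyz]])+
      then show "i \<in> D \<and> j \<in> D \<and> k \<in> D" using s xyz by (auto simp: D_def)
    qed
    obtain p where p: "p < n" "max_pos n f = {p}" using ex_max_pos[OF f_bij n_pos] by blast
    have lp: "l p \<in> max_pos m \<tau>" using p max_label by blast
    have "i = l p" if "i \<in> max_pos m \<tau>" for i
      using that lp tau_eq_iff[of i "l p"] by (auto simp: max_pos_def)
    moreover have "p \<in> kernel n f" using p max_pos_in_kernel by auto
    ultimately show "max_pos m \<tau> \<subseteq> D" using S(2) by (auto simp: D_def)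
  qed
  then show "x \<in> kernel n f" using D_kernel x by auto
qed

text \<open>A kernel point and a point whose label is outside the kernel of the pattern have
  different labels, so their comparisons are those of the labels; by \<open>kernel_eq\<close> both
  sides quantify over the same kernel.\<close>

lemma same_cell_iff:
  assumes xy: "x < n" "y < n"
  shows "same_cell n f x y \<longleftrightarrow> same_cell m \<tau> (l x) (l y)"
proof -
  have cmp: "(a < x \<longleftrightarrow> l a < l x) \<and> (f a < f x \<longleftrightarrow> \<tau> (l a) < \<tau> (l x))"
    if a: "a \<in> kernel n f" and x: "x < n" "l x \<notin> kernel m \<tau>" for a x
  proof -
    have la: "a < n" "l a \<in> kernel m \<tau>" using a by (auto simp: kernel_eq)
    then have "l a \<noteq> l x" using x by auto
    then have "\<tau> (l a) \<noteq> \<tau> (l x)" using la x l_less tau_eq_iff by blast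
    then show ?thesis
      using \<open>l a \<noteq> l x\<close> la x less_of_label[of a x] less_of_label[of x a] mono_l[of a x]
        inflation_less_of_label[OF f, of a x] inflation_less_of_label[OF f, of x a] tau_le_of_f_le[OF f, of a x]
      by linarith
  qed
  have ex: "(\<forall>b\<in>kernel m \<tau>. P b) \<longleftrightarrow> (\<forall>a\<in>kernel n f. P (l a))" for P
    using onto kernel_less[of _ m \<tau>] by (fastforce simp: kernel_eq)
  show ?thesis
  proof (cases "l x \<in> kernel m \<tau> \<or> l y \<in> kernel m \<tau>")
    case True
    then have "x = y \<longleftrightarrow> l x = l y" using S_eqI[of x y] kernel_pattern_subset xy by auto
    then show ?thesis using True xy by (auto simp: same_cell_def kernel_eq)
  next
    case False
    then show ?thesis
      using xy cmp[of _ x] cmp[of _ y] unfolding same_cell_def ex by (auto simp: kernel_eq)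
  qed
qed

end

section \<open>Every permutation is an inflation of a reduced one\<close>

text \<open>The index of the interval containing \<open>x\<close> when intervals of sizes
  \<open>\<nu> 0\<close>, \<open>\<nu> 1\<close>, ... are laid end to end from 0.\<close>

definition label :: "(nat \<Rightarrow> nat) \<Rightarrow> nat \<Rightarrow> nat" where
  "label \<nu> x = (LEAST i. x < (\<Sum>j\<le>i. \<nu> j))"

lemma label_le_iff:
  assumes "x < (\<Sum>j<m. \<nu> j)"
  shows "label \<nu> x \<le> i \<longleftrightarrow> x < (\<Sum>j\<le>i. \<nu> j)"
proof
  have "x < (\<Sum>j\<le>m. \<nu> j)"
    using assms by (simp add: lessThan_Suc_atMost[symmetric])
  then have "x < (\<Sum>j\<le>label \<nu> x. \<nu> j)"
    unfolding label_def by (rule LeastI)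
  moreover assume "label \<nu> x \<le> i"
  then have "(\<Sum>j\<le>label \<nu> x. \<nu> j) \<le> (\<Sum>j\<le>i. \<nu> j)" by (intro sum_mono2) auto
  ultimately show "x < (\<Sum>j\<le>i. \<nu> j)" by linarith
next
  assume "x < (\<Sum>j\<le>i. \<nu> j)"
  then show "label \<nu> x \<le> i" unfolding label_def by (rule Least_le)
qed

lemma label_less_iff:
  assumes "x < (\<Sum>j<m. \<nu> j)"
  shows "label \<nu> x < i \<longleftrightarrow> x < (\<Sum>j<i. \<nu> j)"
proof (cases i)
  case (Suc i')
  then show ?thesis using label_le_iff[OF assms, of i'] by (simp add: less_Suc_eq_le lessThan_Suc_atMost)
qed simp

lemma label_mono: "x \<le> y \<Longrightarrow> y < (\<Sum>j<m. \<nu> j) \<Longrightarrow> label \<nu> x \<le> label \<nu> y"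
  using label_le_iff[of x \<nu> m "label \<nu> y"] label_le_iff[of y \<nu> m "label \<nu> y"] by linarith

lemma card_label:
  assumes "i < m"
  shows "card {x \<in> {..<\<Sum>j<m. \<nu> j}. label \<nu> x = i} = \<nu> i"
proof -
  have "(\<Sum>j\<le>i. \<nu> j) \<le> (\<Sum>j<m. \<nu> j)" using assms by (intro sum_mono2) auto
  then have "x < (\<Sum>j<m. \<nu> j) \<and> label \<nu> x = i \<longleftrightarrow> (\<Sum>j<i. \<nu> j) \<le> x \<and> x < (\<Sum>j\<le>i. \<nu> j)" for x
    using label_le_iff[of x \<nu> m i] label_less_iff[of x \<nu> m i] by (cases "x < (\<Sum>j<m. \<nu> j)") auto
  then have "{x \<in> {..<\<Sum>j<m. \<nu> j}. label \<nu> x = i} = {(\<Sum>j<i. \<nu> j)..<(\<Sum>j\<le>i. \<nu> j)}"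
    by (simp add: set_eq_iff)
  then show ?thesis by (simp add: lessThan_Suc_atMost[symmetric])
qed

text \<open>For a monotone labelling the points with label at most \<open>i\<close> form an initial
  segment, whose length is a partial sum of \<open>\<nu>\<close>; so the fibre sizes determine the
  labelling.\<close>

lemma label_unique:
  fixes l :: "nat \<Rightarrow> nat"
  assumes mono: "\<And>x y. x \<le> y \<Longrightarrow> y < n \<Longrightarrow> l x \<le> l y" and "\<And>x. x < n \<Longrightarrow> l x < m"
    and card: "\<And>i. i < m \<Longrightarrow> card {x \<in> {..<n}. l x = i} = \<nu> i"
    and x: "x < n"
  shows "label \<nu> x = l x"
proof -
  have le: "l y \<le> i \<longleftrightarrow> y < (\<Sum>j\<le>i. \<nu> j)" if i: "i < m" and y: "y < n" for i y
  proof -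
    let ?D = "{z \<in> {..<n}. l z \<le> i}"
    have "?D = (\<Union>j\<le>i. {z \<in> {..<n}. l z = j})" by auto
    then have "card ?D = (\<Sum>j\<le>i. card {z \<in> {..<n}. l z = j})"
      by (simp only:) (intro card_UN_disjoint, auto)
    also have "\<dots> = (\<Sum>j\<le>i. \<nu> j)" using i card by (intro sum.cong) auto
    finally have D: "card ?D = (\<Sum>j\<le>i. \<nu> j)" .
    show ?thesis
    proof
      assume "l y \<le> i"
      then have "{..y} \<subseteq> ?D" using y mono[of _ y] by (auto intro: order.trans)
      then have "card {..y} \<le> card ?D" by (intro card_mono) auto
      then show "y < (\<Sum>j\<le>i. \<nu> j)" using D by simp
    next
      assume *: "y < (\<Sum>j\<le>i. \<nu> j)"
      show "l y \<le> i"
      proof (rule ccontr)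
        assume "\<not> l y \<le> i"
        then have "z < y" if "z \<in> ?D" for z using mono[of y z] that by (cases "y \<le> z") auto
        then have "?D \<subseteq> {..<y}" by blast
        then have "card ?D \<le> card {..<y}" by (intro card_mono) auto
        then show False using D * by simp
      qed
    qed
  qed
  show ?thesis unfolding label_def
  proof (rule Least_equality)
    show "x < (\<Sum>j\<le>l x. \<nu> j)" using le[of "l x" x] x assms(2) by auto
    show "l x \<le> i" if "x < (\<Sum>j\<le>i. \<nu> j)" for i
      using le[of i x] that x assms(2)[OF x] by (cases "i < m") auto
  qed
qed

text \<open>A monotone map onto an initial segment starts at 0 and grows by steps of 0 or 1, so its
  fibres determine it. The two ranges are not assumed equal, since equality of the pattern sizes is
  deduced from this lemma.\<close>

lemma monotone_onto_unique:
  fixes l k :: "nat \<Rightarrow> nat"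
  assumes l: "\<And>x y. x \<le> y \<Longrightarrow> y < n \<Longrightarrow> l x \<le> l y" "l ` {..<n} = {..<m}"
    and k: "\<And>x y. x \<le> y \<Longrightarrow> y < n \<Longrightarrow> k x \<le> k y" "k ` {..<n} = {..<m'}"
    and eq: "\<And>x y. x < n \<Longrightarrow> y < n \<Longrightarrow> l x = l y \<longleftrightarrow> k x = k y"
    and "x < n"
  shows "l x = k x"
proof -
  have n: "0 < n" using \<open>x < n\<close> by simp
  have step: "h 0 = 0 \<and> (\<forall>x. Suc x < n \<longrightarrow> h (Suc x) = h x \<or> h (Suc x) = Suc (h x))"
    if h: "\<And>x y. x \<le> y \<Longrightarrow> y < n \<Longrightarrow> h x \<le> h y" "h ` {..<n} = {..<M}" and "0 < n"
    for h :: "nat \<Rightarrow> nat" and M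
  proof
    have "h 0 < M" using h(2) \<open>0 < n\<close> by auto
    then have "0 \<in> h ` {..<n}" using h(2) by auto
    then obtain z where "z < n" "h z = 0" by auto
    then show "h 0 = 0" using h(1)[of 0 z] by simp
    show "\<forall>x. Suc x < n \<longrightarrow> h (Suc x) = h x \<or> h (Suc x) = Suc (h x)"
    proof (intro allI impI)
      fix x assume x: "Suc x < n"
      show "h (Suc x) = h x \<or> h (Suc x) = Suc (h x)"
      proof (rule ccontr)
        assume "\<not> ?thesis"
        then have *: "Suc (h x) < h (Suc x)" using h(1)[of x "Suc x"] x by auto
        then have "Suc (h x) \<in> h ` {..<n}" using h(2) x by (auto dest: less_trans)
        then obtain y where "y < n" "h y = Suc (h x)" by auto
        then show False using h(1)[of y x] h(1)[of "Suc x" y] x * by (cases "y \<le> x") auto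
      qed
    qed
  qed
  have sl: "l 0 = 0" "\<And>x. Suc x < n \<Longrightarrow> l (Suc x) = l x \<or> l (Suc x) = Suc (l x)"
    using step[of l m, OF l n] by auto
  have sk: "k 0 = 0" "\<And>x. Suc x < n \<Longrightarrow> k (Suc x) = k x \<or> k (Suc x) = Suc (k x)"
    using step[of k m', OF k n] by auto
  show ?thesis using \<open>x < n\<close>
  proof (induction x)
    case 0
    then show ?case using sl(1) sk(1) by simp
  next
    case (Suc x)
    then have "l x = k x" by simp
    moreover have "l x = l (Suc x) \<longleftrightarrow> k x = k (Suc x)" using Suc.prems by (intro eq) auto
    ultimately show ?case using sl(2)[OF Suc.prems] sk(2)[OF Suc.prems] by metis
  qed
qed

lemma ex_convex_labels:
  fixes R :: "nat \<Rightarrow> nat \<Rightarrow> bool"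
  assumes refl: "\<And>x. R x x" and sym: "\<And>x y. R x y \<Longrightarrow> R y x"
    and trans: "\<And>x y z. R x y \<Longrightarrow> R y z \<Longrightarrow> R x z"
    and convex: "\<And>x y z. x \<le> y \<Longrightarrow> y \<le> z \<Longrightarrow> z < n \<Longrightarrow> R x z \<Longrightarrow> R x y"
  shows "\<exists>(l :: nat \<Rightarrow> nat) m. (\<forall>x y. x \<le> y \<longrightarrow> y < n \<longrightarrow> l x \<le> l y) \<and> l ` {..<n} = {..<m} \<and>
    (\<forall>x<n. \<forall>y<n. l x = l y \<longleftrightarrow> R x y)"
proof -
  \<comment> \<open>The label of \<open>x\<close> counts the boundaries between classes to the left
    of \<open>x\<close>.\<close>
  define l where "l = (\<lambda>x. card {y. y < x \<and> \<not> R y (Suc y)})"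
  have mono: "l x \<le> l y" if "x \<le> y" for x y
    unfolding l_def using that by (intro card_mono) auto
  have l_Suc: "l (Suc x) = (if R x (Suc x) then l x else Suc (l x))" for x
  proof -
    have "{y. y < Suc x \<and> \<not> R y (Suc y)} =
        (if R x (Suc x) then {y. y < x \<and> \<not> R y (Suc y)} else insert x {y. y < x \<and> \<not> R y (Suc y)})"
      by (auto simp: less_Suc_eq)
    then show ?thesis by (simp add: l_def)
  qed
  have 0: "l 0 = 0" by (simp add: l_def)
  have hit: "\<exists>y\<le>x. l y = i" if "i \<le> l x" for i x
    using that
  proof (induction x)
    case (Suc x)
    show ?case
    proof (cases "i = l (Suc x)")
      case False
      then have "i \<le> l x" using Suc.prems by (auto simp: l_Suc split: if_splits)
      then show ?thesis using Suc.IH le_SucI by blast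
    qed auto
  qed (simp add: 0)
  have iff: "l x = l y \<longleftrightarrow> R x y" if "x \<le> y" "y < n" for x y
    using that
  proof (induction y rule: dec_induct)
    case (step y)
    have "l x = l (Suc y) \<longleftrightarrow> l x = l y \<and> R y (Suc y)"
      using mono[of x y] step by (auto simp: l_Suc)
    also have "\<dots> \<longleftrightarrow> R x y \<and> R y (Suc y)" using step by simp
    also have "\<dots> \<longleftrightarrow> R x (Suc y)"
      using trans sym convex[of x y "Suc y"] step by (meson le_SucI le_refl)
    finally show ?case .
  qed (simp add: refl)
  show ?thesis
  proof (intro exI conjI allI impI)
    show "l ` {..<n} = {..<if n = 0 then 0 else Suc (l (n - 1))}"
    proof (cases "n = 0")
      case False
      then have "l x \<le> l (n - 1)" if "x < n" for x using that by (intro mono) simp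
      moreover have "i \<in> l ` {..<n}" if "i \<le> l (n - 1)" for i
        using hit[OF that] False by fastforce
      ultimately show ?thesis using False by (auto simp: less_Suc_eq_le)
    qed simp
    show "l x = l y \<longleftrightarrow> R x y" if "x < n" "y < n" for x y
      using iff[of x y] iff[of y x] that sym by (cases "x \<le> y") auto
    show "l x \<le> l y" if "x \<le> y" for x y using that by (rule mono)
  qed
qed

text \<open>\<open>\<nu>\<close> is indexed by pattern positions. In order of values, the block at
  height j belongs to position \<open>inv_into {..<m} \<tau> j\<close>, whence the permuted sizes
  for the value labels.\<close>

definition inflation_set :: "nat \<Rightarrow> (nat \<Rightarrow> nat) \<Rightarrow> (nat \<Rightarrow> nat) \<Rightarrow> nat \<Rightarrow> (nat \<Rightarrow> nat) set" where
  "inflation_set m \<tau> \<nu> n = {f \<in> bijs {..<n} {..<n}.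
    \<forall>x<n. label (\<nu> \<circ> inv_into {..<m} \<tau>) (f x) = \<tau> (label \<nu> x)}"

text \<open>Nonempty blocks, singletons over the kernel and a reduced pattern together form the
  normal form that makes the decomposition of a permutation unique.\<close>

definition skeleton :: "nat \<Rightarrow> (nat \<Rightarrow> nat) \<Rightarrow> (nat \<Rightarrow> nat) \<Rightarrow> nat \<Rightarrow> bool" where
  "skeleton m \<tau> \<nu> n \<longleftrightarrow> \<tau> \<in> bijs {..<m} {..<m} \<and> reduced m \<tau> \<and> (\<forall>i<m. \<nu> i > 0) \<and>
    (\<forall>i\<in>kernel m \<tau>. \<nu> i = 1) \<and> (\<Sum>i<m. \<nu> i) = n"

lemma block_labels_label:
  assumes tau: "bij_betw \<tau> {..<m} {..<m}" and n: "(\<Sum>i<m. \<nu> i) = n"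
  shows "block_labels n m \<tau> (label \<nu>) (label (\<nu> \<circ> inv_into {..<m} \<tau>)) \<nu>"
proof -
  have n': "(\<Sum>i<m. (\<nu> \<circ> inv_into {..<m} \<tau>) i) = n"
    using sum.reindex_bij_betw[OF bij_betw_inv_into[OF tau], of \<nu>] n by simp
  have "label \<mu> x < m" if "(\<Sum>i<m. \<mu> i) = n" "x < n" for \<mu> x
    using label_less_iff[of x \<mu> m m] that by simp
  moreover have "(\<nu> \<circ> inv_into {..<m} \<tau>) (\<tau> i) = \<nu> i" if "i < m" for i
    using that tau by (simp add: bij_betw_inv_into_left)
  moreover have "\<tau> i < m" if "i < m" for i using that tau by (auto simp: bij_betw_def)
  ultimately show ?thesis
    using n n' tau label_mono[of _ _ \<nu> m] label_mono[of _ _ "\<nu> \<circ> inv_into {..<m} \<tau>" m]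
      card_label[of _ m \<nu>] card_label[of _ m "\<nu> \<circ> inv_into {..<m} \<tau>"]
    by unfold_locales auto
qed

text \<open>In a reduced pattern the upper right end of an increasing pair is a kernel point:
  otherwise its lower left partner is outside the kernel as well, and both share a cell. Kernel
  blocks are singletons.\<close>

lemma skeleton_rigid:
  assumes "skeleton m \<tau> \<nu> n"
  shows "rigid_labels n m \<tau> (label \<nu>) (label (\<nu> \<circ> inv_into {..<m} \<tau>)) \<nu>"
proof -
  have b: "\<tau> \<in> bijs {..<m} {..<m}" and red: "reduced m \<tau>"
    using assms by (auto simp: skeleton_def)
  interpret block_labels n m \<tau> "label \<nu>" "label (\<nu> \<circ> inv_into {..<m} \<tau>)" \<nu>
    using assms by (intro block_labels_label) (auto simp: skeleton_def bijs_def)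
  have inc: "j \<in> kernel m \<tau>" if "i < j" "j < m" "\<tau> i < \<tau> j" for i j
    using increasing_same_cell[OF b that] kernel_not_below_left[OF b, of j i] red that
    unfolding reduced_def by (metis less_asym less_irrefl less_trans)
  show ?thesis
  proof
    show "\<nu> j \<le> 1" if "i < j" "j < m" "\<tau> i < \<tau> j" for i j
      using inc[OF that] assms by (auto simp: skeleton_def)
    show "\<nu> i = 1 \<and> \<nu> j = 1 \<and> \<nu> k = 1" if "(i, j, k) \<in> occs {..<m} \<tau>" for i j k
      using inc[of i j] kernel_occ[OF that] that assms by (auto simp: skeleton_def occs_def)
  qed
qed

lemma skeleton_transfer:
  assumes sk: "skeleton m \<tau> \<nu> n" and f: "f \<in> inflation_set m \<tau> \<nu> n" and n: "n > 0"
  shows "kernel_transfer n m \<tau> (label \<nu>) (label (\<nu> \<circ> inv_into {..<m} \<tau>)) \<nu> f (kernel m \<tau>)"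
proof -
  interpret rigid_labels n m \<tau> "label \<nu>" "label (\<nu> \<circ> inv_into {..<m} \<tau>)" \<nu>
    using sk by (rule skeleton_rigid)
  have b: "\<tau> \<in> bijs {..<m} {..<m}" and red: "reduced m \<tau>"
    and one: "\<And>i. i \<in> kernel m \<tau> \<Longrightarrow> \<nu> i = 1"
    using sk by (auto simp: skeleton_def)
  have f': "f \<in> inflations" using f by (simp add: inflation_set_def inflations_def)
  show ?thesis
  proof
    show "label \<nu> x = label \<nu> y \<and> label \<nu> z = label \<nu> y \<and> label \<nu> x \<notin> kernel m \<tau> \<or>
        label \<nu> x \<in> kernel m \<tau> \<and> label \<nu> y \<in> kernel m \<tau> \<and> label \<nu> z \<in> kernel m \<tau>"
      if o: "(x, y, z) \<in> occs {..<n} f" for x y z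
      using occ_label_cases[OF f' o]
    proof
      assume "label \<nu> x = label \<nu> y \<and> label \<nu> z = label \<nu> y"
      then show ?thesis using block_eqI[of x y] one[of "label \<nu> x"] o by (auto simp: occs_def)
    next
      assume *: "(label \<nu> x, label \<nu> y, label \<nu> z) \<in> occs {..<m} \<tau>"
      then have "label \<nu> x < label \<nu> y" "label \<nu> y < m" "\<tau> (label \<nu> x) < \<tau> (label \<nu> y)"
        by (auto simp: occs_def)
      \<comment> \<open>The first two points of an occurrence form an increasing pair, which in a
        reduced pattern cannot avoid the kernel.\<close>
      then have "label \<nu> x \<in> kernel m \<tau> \<or> label \<nu> y \<in> kernel m \<tau>"
        using increasing_same_cell[OF b, of "label \<nu> x" "label \<nu> y"] red
        unfolding reduced_def by (metis less_irrefl less_trans)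
      then show ?thesis using kernel_occ[OF *] by blast
    qed
  qed (use sk f' n kernel_subset max_pos_in_kernel in \<open>auto simp: skeleton_def\<close>)
qed

text \<open>By \<open>same_cell_iff\<close> and reducedness, the blocks are the cells of
  \<open>f\<close>, so both position labellings and both value labellings have the same fibres and
  coincide by \<open>monotone_onto_unique\<close>. The pattern is then read off from the labels of
  \<open>x\<close> and \<open>f x\<close>.\<close>

lemma skeleton_unique:
  assumes sk: "skeleton m \<tau> \<nu> n" "f \<in> inflation_set m \<tau> \<nu> n"
    and sk': "skeleton m' \<tau>' \<nu>' n" "f \<in> inflation_set m' \<tau>' \<nu>' n" and n: "n > 0"
  shows "m = m'" "\<tau> = \<tau>'" "\<forall>i<m. \<nu> i = \<nu>' i"
proof -
  interpret A: kernel_transfer n m \<tau> "label \<nu>" "label (\<nu> \<circ> inv_into {..<m} \<tau>)" \<nu> f "kernel m \<tau>"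
    using skeleton_transfer[OF sk n] .
  interpret B: kernel_transfer n m' \<tau>' "label \<nu>'" "label (\<nu>' \<circ> inv_into {..<m'} \<tau>')" \<nu>' f "kernel m' \<tau>'"
    using skeleton_transfer[OF sk' n] .
  let ?l = "label \<nu>" and ?k = "label \<nu>'"
  have im: "?l ` {..<n} = {..<m}" "?k ` {..<n} = {..<m'}"
    using A.onto A.l_less B.onto B.l_less by fastforce+
  have tau: "\<tau> ` {..<m} = {..<m}" "\<tau>' ` {..<m'} = {..<m'}"
    using A.tau B.tau by (auto simp: bij_betw_def)
  have iff: "?l x = ?l y \<longleftrightarrow> ?k x = ?k y" if "x < n" "y < n" for x y
  proof -
    have "?l x = ?l y \<longleftrightarrow> same_cell n f x y"
      using A.same_cell_iff[OF that] sk(1) A.l_less that same_cell_refl[OF A.f_bij]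
      by (auto simp: skeleton_def reduced_def same_cell_def)
    moreover have "?k x = ?k y \<longleftrightarrow> same_cell n f x y"
      using B.same_cell_iff[OF that] sk'(1) B.l_less that
      by (auto simp: skeleton_def reduced_def same_cell_def)
    ultimately show ?thesis by simp
  qed
  have eq: "?l x = ?k x" if "x < n" for x
    by (rule monotone_onto_unique[OF _ im(1) _ im(2) iff that]) (auto intro: A.mono_l B.mono_l)
  then have "?l ` {..<n} = ?k ` {..<n}" by (intro image_cong) auto
  then show m: "m = m'" using im by simp
  show "\<forall>i<m. \<nu> i = \<nu>' i"
  proof (intro allI impI)
    fix i assume "i < m"
    moreover have "{x \<in> {..<n}. ?l x = i} = {x \<in> {..<n}. ?k x = i}" using eq by auto
    ultimately show "\<nu> i = \<nu>' i" using A.card_l[of i] B.card_l[of i] m by simp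
  qed
  let ?l' = "label (\<nu> \<circ> inv_into {..<m} \<tau>)" and ?k' = "label (\<nu>' \<circ> inv_into {..<m'} \<tau>')"
  have f_onto: "\<exists>x<n. f x = y" if "y < n" for y
  proof -
    have "y \<in> f ` {..<n}" using A.f_bij that by (simp add: bijs_def bij_betw_def)
    then show ?thesis by auto
  qed
  have im': "?l' ` {..<n} = {..<m}"
  proof
    show "{..<m} \<subseteq> ?l' ` {..<n}"
    proof
      fix j assume "j \<in> {..<m}"
      then obtain i where "i < m" "j = \<tau> i" using tau(1) by (metis imageE lessThan_iff)
      then show "j \<in> ?l' ` {..<n}" using A.onto'[of i] by force
    qed
  qed (use A.l'_less in auto)
  have im'': "?k' ` {..<n} = {..<m'}"
  proof
    show "{..<m'} \<subseteq> ?k' ` {..<n}"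
    proof
      fix j assume "j \<in> {..<m'}"
      then obtain i where "i < m'" "j = \<tau>' i" using tau(2) by (metis imageE lessThan_iff)
      then show "j \<in> ?k' ` {..<n}" using B.onto'[of i] by force
    qed
  qed (use B.l'_less in auto)
  have iff': "?l' v = ?l' w \<longleftrightarrow> ?k' v = ?k' w" if vw: "v < n" "w < n" for v w
  proof -
    obtain x y where "x < n" "f x = v" "y < n" "f y = w" using f_onto[OF vw(1)] f_onto[OF vw(2)] by blast
    then show ?thesis
      using A.inflation_label[OF A.f, of x] A.inflation_label[OF A.f, of y] B.inflation_label[OF B.f, of x] B.inflation_label[OF B.f, of y]
        A.tau_eq_iff[OF A.l_less A.l_less, of x y] B.tau_eq_iff[OF B.l_less B.l_less, of x y] iff[of x y]
      by simp
  qed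
  have eq': "?l' x = ?k' x" if "x < n" for x
    by (rule monotone_onto_unique[OF _ im' _ im'' iff' that]) (auto intro: A.mono_l' B.mono_l')
  show "\<tau> = \<tau>'"
  proof
    fix i show "\<tau> i = \<tau>' i"
    proof (cases "i < m")
      case True
      then obtain x where x: "x < n" "?l x = i" using A.onto by blast
      then have "\<tau> i = ?l' (f x)" using A.inflation_label[OF A.f, of x] by simp
      also have "\<dots> = ?k' (f x)" using eq'[of "f x"] bijs_less[OF A.f_bij] x by simp
      also have "\<dots> = \<tau>' i" using B.inflation_label[OF B.f, of x] x eq[of x] by simp
      finally show ?thesis .
    next
      case False
      then show ?thesis using sk sk' m by (auto simp: skeleton_def bijs_def extensional_def)
    qed
  qed
qed


text \<open>By convexity the cells of \<open>f\<close> can be numbered by position and, through the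
  inverse \<open>g\<close>, by value; the pattern sends the first number of a cell to the
  second.\<close>

lemma skeleton_exists:
  assumes f: "f \<in> bijs {..<n} {..<n}" and n: "n > 0"
  shows "\<exists>m \<tau> \<nu>. skeleton m \<tau> \<nu> n \<and> f \<in> inflation_set m \<tau> \<nu> n \<and> (\<forall>i\<ge>m. \<nu> i = 0)"
proof -
  let ?K = "kernel n f" and ?R = "same_cell n f"
  define g where "g = inv_into {..<n} f"
  have bf: "bij_betw f {..<n} {..<n}" using f by (simp add: bijs_def)
  have g: "g v < n" "f (g v) = v" if "v < n" for v
    using bij_betw_inv_into[OF bf] bij_betw_inv_into_right[OF bf] that
    by (auto simp: g_def bij_betw_def)
  have gf: "g (f x) = x" if "x < n" for x
    using that bf by (simp add: g_def bij_betw_inv_into_left)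
  note fr = bijs_less[OF f]
  have R: "?R x x" "?R x y \<Longrightarrow> ?R y x" "?R x y \<Longrightarrow> ?R y z \<Longrightarrow> ?R x z" for x y z
    by (auto simp: same_cell_def)
  have conv: "?R x y" if "x \<le> y" "y \<le> z" "z < n" "?R x z" for x y z
    using same_cell_convex[OF f, of x y z] that by auto
  have conv': "?R (g x) (g y)" if "x \<le> y" "y \<le> z" "z < n" "?R (g x) (g z)" for x y z
    using same_cell_convex[OF f, of "g x" "g y" "g z"] that g by auto
  have "\<exists>(l :: nat \<Rightarrow> nat) m. (\<forall>x y. x \<le> y \<longrightarrow> y < n \<longrightarrow> l x \<le> l y) \<and> l ` {..<n} = {..<m} \<and>
      (\<forall>x<n. \<forall>y<n. l x = l y \<longleftrightarrow> ?R x y)"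
    by (rule ex_convex_labels) (fact R conv)+
  then obtain l :: "nat \<Rightarrow> nat" and m where l0: "\<forall>x y. x \<le> y \<longrightarrow> y < n \<longrightarrow> l x \<le> l y" "l ` {..<n} = {..<m}"
    "\<forall>x<n. \<forall>y<n. l x = l y \<longleftrightarrow> ?R x y" by auto
  have "\<exists>(l :: nat \<Rightarrow> nat) m. (\<forall>x y. x \<le> y \<longrightarrow> y < n \<longrightarrow> l x \<le> l y) \<and> l ` {..<n} = {..<m} \<and>
      (\<forall>x<n. \<forall>y<n. l x = l y \<longleftrightarrow> ?R (g x) (g y))"
    by (rule ex_convex_labels) (fact R conv')+
  then obtain l' :: "nat \<Rightarrow> nat" and m' where l0': "\<forall>x y. x \<le> y \<longrightarrow> y < n \<longrightarrow> l' x \<le> l' y" "l' ` {..<n} = {..<m'}"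
    "\<forall>x<n. \<forall>y<n. l' x = l' y \<longleftrightarrow> ?R (g x) (g y)" by auto
  note l = l0(1)[rule_format] l0(2) l0(3)[rule_format]
  note l' = l0'(1)[rule_format] l0'(2) l0'(3)[rule_format]
  have l_less: "l x < m" and l'_less: "l' x < m'" if "x < n" for x using l(2) l'(2) that by blast+
  have l_onto: "\<exists>x<n. l x = i" if "i < m" for i
  proof -
    have "i \<in> l ` {..<n}" using that l(2) by simp
    then show ?thesis by auto
  qed
  define \<tau> where "\<tau> = (\<lambda>i\<in>{..<m}. l' (f (SOME x. x < n \<and> l x = i)))"
  have tau_l: "\<tau> (l x) = l' (f x)" if x: "x < n" for x
  proof -
    define y where "y = (SOME y. y < n \<and> l y = l x)"
    have y: "y < n \<and> l y = l x" unfolding y_def by (rule someI[of _ x]) (use x in auto)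
    then have "?R y x" using l(3)[of y x] x by blast
    then have "l' (f y) = l' (f x)" using l'(3)[of "f y" "f x"] fr x y gf by simp
    then show ?thesis using l_less[OF x] by (simp add: \<tau>_def y_def)
  qed
  have tau: "bij_betw \<tau> {..<m} {..<m'}"
    unfolding bij_betw_def
  proof
    show "inj_on \<tau> {..<m}"
    proof (rule inj_onI)
      fix i j assume ij: "i \<in> {..<m}" "j \<in> {..<m}" "\<tau> i = \<tau> j"
      then obtain x y where "x < n" "l x = i" "y < n" "l y = j" using l_onto by (metis lessThan_iff)
      then show "i = j" using ij(3) tau_l[of x] tau_l[of y] l'(3)[of "f x" "f y"] l(3)[of x y] fr gf by auto
    qed
    have "\<tau> ` {..<m} = (\<lambda>x. \<tau> (l x)) ` {..<n}" using l(2) by (simp add: image_image[symmetric])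
    also have "\<dots> = (\<lambda>x. l' (f x)) ` {..<n}" using tau_l by (intro image_cong) auto
    also have "\<dots> = l' ` (f ` {..<n})" by (simp add: image_image)
    also have "\<dots> = {..<m'}" using bf l'(2) by (simp add: bij_betw_def)
    finally show "\<tau> ` {..<m} = {..<m'}" .
  qed
  then have mm: "m' = m" using bij_betw_same_card[OF tau] by simp
  define \<nu> where "\<nu> = (\<lambda>i. card {x \<in> {..<n}. l x = i})"
  have card': "card {y \<in> {..<n}. l' y = \<tau> i} = \<nu> i" if i: "i < m" for i
  proof -
    have "bij_betw f {x \<in> {..<n}. l x = i} {y \<in> {..<n}. l' y = \<tau> i}"
      unfolding bij_betw_def
    proof
      show "inj_on f {x \<in> {..<n}. l x = i}" using bf by (auto simp: bij_betw_def inj_on_def)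
      show "f ` {x \<in> {..<n}. l x = i} = {y \<in> {..<n}. l' y = \<tau> i}"
      proof (intro equalityI subsetI)
        fix y assume "y \<in> {y \<in> {..<n}. l' y = \<tau> i}"
        then have y: "y < n" "l' y = \<tau> i" by auto
        then have "\<tau> (l (g y)) = \<tau> i" using tau_l[of "g y"] g by simp
        then have "l (g y) = i" using tau i l_less[of "g y"] g y by (auto simp: bij_betw_def inj_on_def)
        then show "y \<in> f ` {x \<in> {..<n}. l x = i}" using g[OF y(1)] by force
      qed (use fr tau_l in auto)
    qed
    then show ?thesis by (simp add: \<nu>_def bij_betw_same_card)
  qed
  interpret block_labels n m \<tau> l l' \<nu>
    using tau l l' l_less l'_less card' mm by unfold_locales (auto simp: \<nu>_def)
  have fI: "f \<in> inflations" using f tau_l by (auto simp: inflations_def)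
  interpret kernel_transfer n m \<tau> l l' \<nu> f "l ` ?K"
  proof
    show "f \<in> inflations" by fact
    show "n > 0" by fact
    show "\<nu> i > 0" if "i < m" for i
      using l_onto[OF that] by (auto simp: \<nu>_def card_gt_0_iff)
    show "l ` ?K \<subseteq> {..<m}" using l_less kernel_less by auto
    show "max_pos m \<tau> \<subseteq> l ` ?K"
    proof
      fix i assume "i \<in> max_pos m \<tau>"
      then have i: "i < m" "\<tau> i = m - 1" by (auto simp: max_pos_def)
      obtain p where p: "p < n" "max_pos n f = {p}" using ex_max_pos[OF f n] by blast
      then have "p \<in> max_pos n f" by simp
      then have fp: "f p = n - 1" unfolding max_pos_def by auto
      have "m - 1 \<in> l' ` {..<n}" using l'(2) mm i by auto
      then obtain y where "y < n" "l' y = m - 1" by auto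
      then have "m - 1 \<le> l' (n - 1)" using l'(1)[of y "n - 1"] by auto
      then have "\<tau> (l p) = \<tau> i" using tau_l[OF p(1)] fp i l'_less[of "n - 1"] n mm by auto
      then have "l p = i" using tau_eq_iff[OF l_less[OF p(1)] i(1)] by simp
      then show "i \<in> l ` ?K" using p max_pos_in_kernel[of n f] by blast
    qed
    have inK: "x = p" if "p \<in> ?K" "x < n" "l x = l p" for x p
      using l(3)[of x p] that kernel_less[of p n f] by (auto simp: same_cell_def)
    show "\<nu> i = 1" if i: "i \<in> l ` ?K" for i
    proof -
      obtain p where p: "p \<in> ?K" "i = l p" using i by auto
      then have "{x \<in> {..<n}. l x = i} = {p}" using inK kernel_less by auto
      then show ?thesis by (simp add: \<nu>_def)
    qed
    show "l x = l y \<and> l z = l y \<and> l x \<notin> l ` ?K \<or> l x \<in> l ` ?K \<and> l y \<in> l ` ?K \<and> l z \<in> l ` ?K"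
      if o: "(x, y, z) \<in> occs {..<n} f" for x y z
    proof (cases "x \<in> ?K \<or> y \<in> ?K \<or> z \<in> ?K")
      case True
      then show ?thesis using kernel_occ[OF o] by blast
    next
      case False
      have o': "x < n" "y < n" "z < n" "x < y" "y < z" "f x < f z" "f z < f y"
        using o by (auto simp: occs_def)
      \<comment> \<open>Both pairs are increasing and avoid the kernel, so the whole occurrence lies
        in one cell.\<close>
      then have "?R x y" "?R x z" using False increasing_same_cell[OF f] by auto
      then have "l x = l y" "l z = l y" using l(3) o' by (metis R(2), metis R(2) R(3))
      moreover have "l x \<notin> l ` ?K" using inK[of _ x] False o' by auto
      ultimately show ?thesis by simp
    qed
  qed
  \<comment> \<open>This carries the size condition of \<open>skeleton\<close> from the labels of
    the kernel of \<open>f\<close> over to the kernel of \<open>\<tau>\<close>.\<close>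
  have K_sub: "kernel m \<tau> \<subseteq> l ` ?K" by (rule kernel_pattern_subset)
  have tb: "\<tau> \<in> bijs {..<m} {..<m}" using tau mm by (simp add: bijs_def \<tau>_def)
  have "reduced m \<tau>"
    unfolding reduced_def
  proof (intro allI impI)
    fix i j assume ij: "i < m" "j < m" "same_cell m \<tau> i j"
    then obtain x y where "x < n" "l x = i" "y < n" "l y = j" using l_onto by metis
    then show "i = j" using ij same_cell_iff[of x y] l(3)[of x y] by auto
  qed
  moreover have sum: "(\<Sum>i<m. \<nu> i) = n"
  proof -
    have "(\<Sum>i<m. \<nu> i) = card (\<Union>i<m. {x \<in> {..<n}. l x = i})"
      unfolding \<nu>_def by (intro card_UN_disjoint[symmetric]) auto
    also have "(\<Union>i<m. {x \<in> {..<n}. l x = i}) = {..<n}" using l_less by auto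
    finally show ?thesis by simp
  qed
  ultimately have "skeleton m \<tau> \<nu> n"
    unfolding skeleton_def using tb single subsetD[OF K_sub] nonempty by blast
  moreover have "f \<in> inflation_set m \<tau> \<nu> n"
  proof -
    have "label \<nu> x = l x" if "x < n" for x
      using l(1) l_less card_l that by (rule label_unique)
    moreover have "label (\<nu> \<circ> inv_into {..<m} \<tau>) y = l' y" if "y < n" for y
      using l'(1) l'_less[unfolded mm] _ that
    proof (rule label_unique)
      fix j assume "j < m"
      then have "inv_into {..<m} \<tau> j < m" "\<tau> (inv_into {..<m} \<tau> j) = j"
        using bij_betw_inv_into[OF tau] bij_betw_inv_into_right[OF tau] mm by (auto simp: bij_betw_def)
      then show "card {y \<in> {..<n}. l' y = j} = (\<nu> \<circ> inv_into {..<m} \<tau>) j"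
        using card_l'[of "inv_into {..<m} \<tau> j"] by simp
    qed
    ultimately show ?thesis using f_bij tau_l fr by (auto simp: inflation_set_def)
  qed
  \<comment> \<open>Vanishing beyond \<open>m\<close> allows \<open>\<nu>\<close> to be read as the
    count function of a multiset.\<close>
  moreover have "\<forall>i\<ge>m. \<nu> i = 0"
    using l_less by (force simp: \<nu>_def)
  ultimately show ?thesis by blast
qed

section \<open>The recurrence for signed permutation counts\<close>

lemma wt_nth_eq_0: "r < card (occs A f) \<Longrightarrow> wt A f $ r = 0"
  by (simp add: wt_def fps_X_power_mult_right_nth)

text \<open>Patterns without occurrences belong to the trivial kernel, which is summed separately;
  those with more than \<open>r\<close> occurrences cannot affect the coefficient of q^r.\<close>

definition patterns :: "nat \<Rightarrow> (nat \<times> (nat \<Rightarrow> nat)) set" where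
  "patterns r = {(m, \<tau>). \<tau> \<in> bijs {..<m} {..<m} \<and> reduced m \<tau> \<and>
    occs {..<m} \<tau> \<noteq> {} \<and> card (occs {..<m} \<tau>) \<le> r}"

text \<open>Sizes are encoded as a multiset of labels, block \<open>i\<close> having size
  \<open>count X i\<close>, to match the coefficient formula \<open>fps_prod_nth'\<close> for finite
  products.\<close>

definition block_sizes :: "nat \<Rightarrow> (nat \<Rightarrow> nat) \<Rightarrow> nat \<Rightarrow> nat multiset set" where
  "block_sizes m \<tau> n = {X \<in> multisets_of_size {..<m} n.
    (\<forall>i<m. count X i > 0) \<and> (\<forall>i\<in>kernel m \<tau>. count X i = 1)}"

lemma finite_patterns: "finite (patterns r)"
proof -
  \<comment> \<open>By \<open>card_kernel_le\<close> the kernel has at most 1 + 3 * r points, and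
    \<open>reduced_size_le\<close> bounds the whole pattern by k + 4 ^ k for a kernel of size
    k.\<close>
  let ?B = "1 + 3 * r + 4 ^ (1 + 3 * r)"
  have "patterns r \<subseteq> (SIGMA m:{..?B}. bijs {..<m} {..<m})"
  proof (clarsimp simp: patterns_def)
    fix m \<tau> assume t: "\<tau> \<in> bijs {..<m} {..<m}" "reduced m \<tau>" "occs {..<m} \<tau> \<noteq> {}"
      "card (occs {..<m} \<tau>) \<le> r"
    have "m > 0" using t(3) by (auto simp: occs_def)
    then have k: "card (kernel m \<tau>) \<le> 1 + 3 * r"
      using card_kernel_le[OF t(1)] t(4) by linarith
    have "m \<le> card (kernel m \<tau>) + 4 ^ card (kernel m \<tau>)" using reduced_size_le[OF t(1,2)] .
    also have "\<dots> \<le> 1 + 3 * r + 4 ^ (1 + 3 * r)"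
      using k by (intro add_mono power_increasing) auto
    finally show "m \<le> Suc (3 * r + 4 * 4 ^ (3 * r))" by simp
  qed
  then show ?thesis by (rule finite_subset) auto
qed

lemma finite_block_sizes: "finite (block_sizes m \<tau> n)"
  unfolding block_sizes_def by (rule finite_subset[OF _ finite_multisets_of_size[of "{..<m}" n]]) auto

lemma size_eq_sum_count:
  fixes m :: nat
  shows "set_mset X \<subseteq> {..<m} \<Longrightarrow> size X = (\<Sum>i<m. count X i)"
  unfolding size_multiset_overloaded_eq
  by (rule sum.mono_neutral_left) (simp_all, auto simp: not_in_iff)

lemma skeleton_block_sizes:
  assumes "(m, \<tau>) \<in> patterns r" "X \<in> block_sizes m \<tau> n"
  shows "skeleton m \<tau> (count X) n"
  using assms size_eq_sum_count[of X m]
  by (auto simp: patterns_def block_sizes_def skeleton_def multisets_of_size_def)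

lemma kernel_trivial_iff:
  assumes sk: "skeleton m \<tau> \<nu> n" and f: "f \<in> inflation_set m \<tau> \<nu> n" and n: "n > 0"
  shows "kernel n f = max_pos n f \<longleftrightarrow> occs {..<m} \<tau> = {}"
proof -
  interpret kernel_transfer n m \<tau> "label \<nu>" "label (\<nu> \<circ> inv_into {..<m} \<tau>)" \<nu> f "kernel m \<tau>"
    using skeleton_transfer[OF assms] .
  have tb: "\<tau> \<in> bijs {..<m} {..<m}" using sk by (simp add: skeleton_def)
  obtain p where p: "p < n" "max_pos n f = {p}" using ex_max_pos[OF f_bij n] by blast
  show ?thesis
  proof
    assume "occs {..<m} \<tau> = {}"
    then have "kernel m \<tau> = max_pos m \<tau>" by (rule kernel_no_occs[OF tb])
    moreover obtain q where "max_pos m \<tau> = {q}"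
      using ex_max_pos[OF tb] l_less[OF p(1)] by auto
    ultimately have K: "kernel m \<tau> = {q}" by simp
    have "p \<in> kernel n f" using max_pos_in_kernel[of n f] p by simp
    then have "label \<nu> p = q" by (simp add: kernel_eq K)
    then have "x = p" if "x \<in> kernel n f" for x
      using that S_eqI[of x p] p(1) unfolding kernel_eq K by simp
    then show "kernel n f = max_pos n f" unfolding p(2) using \<open>p \<in> kernel n f\<close> by blast
  next
    assume K: "kernel n f = max_pos n f"
    show "occs {..<m} \<tau> = {}"
    proof (rule ccontr)
      assume "occs {..<m} \<tau> \<noteq> {}"
      then obtain i j k where o: "(i, j, k) \<in> occs {..<m} \<tau>" by fastforce
      obtain x y z where xyz: "x < n" "y < n" "z < n" "label \<nu> x = i" "label \<nu> y = j" "label \<nu> z = k"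
        using occ_preimage[OF o] .
      then have "x \<in> kernel n f" "y \<in> kernel n f" using occ_in_S[OF o] by (auto simp: kernel_eq)
      then have "x = y" using K p by simp
      then show False using xyz o by (auto simp: occs_def)
    qed
  qed
qed

lemma inflation_sum:
  assumes "skeleton m \<tau> \<nu> n"
  shows "(\<Sum>f\<in>inflation_set m \<tau> \<nu> n. wt {..<n} f) =
    (- 1) ^ (\<Sum>(i, j)\<in>invs {..<m} \<tau>. \<nu> i * \<nu> j) * fps_X ^ card (occs {..<m} \<tau>) *
    (\<Prod>i<m. perm_sum (\<nu> i))"
proof -
  interpret rigid_labels n m \<tau> "label \<nu>" "label (\<nu> \<circ> inv_into {..<m} \<tau>)" \<nu>
    using assms by (rule skeleton_rigid)
  show ?thesis using sum_wt_inflations by (simp add: inflation_set_def inflations_def)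
qed

text \<open>The inflation sets are disjoint by \<open>skeleton_unique\<close>. By
  \<open>skeleton_exists\<close> a permutation they miss comes from a pattern with more than
  \<open>r\<close> occurrences, all of which survive inflation, so its weight has no term in
  q^r.\<close>

lemma nontrivial_kernel_sum:
  assumes n: "n > 0"
  shows "(\<Sum>f | f \<in> bijs {..<n} {..<n} \<and> kernel n f \<noteq> max_pos n f. wt {..<n} f $ r) =
    (\<Sum>(m, \<tau>)\<in>patterns r. \<Sum>X\<in>block_sizes m \<tau> n. (\<Sum>f\<in>inflation_set m \<tau> (count X) n. wt {..<n} f) $ r)"
proof -
  define U where "U = (SIGMA p:patterns r. block_sizes (fst p) (snd p) n)"
  define I where "I = (\<lambda>u. inflation_set (fst (fst u)) (snd (fst u)) (count (snd u)) n)"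
  have fU: "finite U" unfolding U_def by (intro finite_SigmaI finite_patterns finite_block_sizes)
  have I_sub: "I u \<subseteq> bijs {..<n} {..<n}" for u by (auto simp: I_def inflation_set_def)
  have fI: "finite (I u)" for u by (rule finite_subset[OF I_sub]) auto
  have sk: "skeleton (fst (fst u)) (snd (fst u)) (count (snd u)) n" if "u \<in> U" for u
    using that skeleton_block_sizes by (auto simp: U_def)
  have disj: "I u \<inter> I v = {}" if uv: "u \<in> U" "v \<in> U" "u \<noteq> v" for u v
  proof (rule ccontr)
    assume "I u \<inter> I v \<noteq> {}"
    then obtain f where f: "f \<in> I u" "f \<in> I v" by blast
    have eq: "fst (fst u) = fst (fst v)" "snd (fst u) = snd (fst v)"
      "\<forall>i<fst (fst u). count (snd u) i = count (snd v) i"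
      using skeleton_unique[OF sk[OF uv(1)] f(1)[unfolded I_def] sk[OF uv(2)] f(2)[unfolded I_def] n]
      by auto
    have "set_mset (snd u) \<subseteq> {..<fst (fst u)}" "set_mset (snd v) \<subseteq> {..<fst (fst u)}"
      using uv eq(1) by (auto simp: U_def block_sizes_def multisets_of_size_def)
    then have "i \<notin># snd u" "i \<notin># snd v" if "\<not> i < fst (fst u)" for i using that by auto
    then have "count (snd u) i = count (snd v) i" for i
      using eq(3) by (cases "i < fst (fst u)") (simp_all add: not_in_iff)
    then have "snd u = snd v" by (rule multiset_eqI)
    then show False using eq uv(3) by (simp add: prod_eq_iff)
  qed
  have "(\<Sum>(m, \<tau>)\<in>patterns r. \<Sum>X\<in>block_sizes m \<tau> n. (\<Sum>f\<in>inflation_set m \<tau> (count X) n. wt {..<n} f) $ r)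
      = (\<Sum>u\<in>U. \<Sum>f\<in>I u. wt {..<n} f $ r)"
    unfolding U_def I_def case_prod_unfold fps_sum_nth
    by (subst sum.Sigma) (auto simp: finite_patterns finite_block_sizes case_prod_unfold)
  also have "\<dots> = (\<Sum>f\<in>(\<Union>u\<in>U. I u). wt {..<n} f $ r)"
    using fU fI disj by (intro sum.UNION_disjoint[symmetric]) auto
  also have "\<dots> = (\<Sum>f | f \<in> bijs {..<n} {..<n} \<and> kernel n f \<noteq> max_pos n f. wt {..<n} f $ r)"
  proof (rule sum.mono_neutral_left)
    show "(\<Union>u\<in>U. I u) \<subseteq> {f. f \<in> bijs {..<n} {..<n} \<and> kernel n f \<noteq> max_pos n f}"
    proof
      fix f assume "f \<in> (\<Union>u\<in>U. I u)"
      then obtain u where u: "u \<in> U" "f \<in> I u" by blast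
      have "occs {..<fst (fst u)} (snd (fst u)) \<noteq> {}" using u(1) by (auto simp: U_def patterns_def)
      then show "f \<in> {f. f \<in> bijs {..<n} {..<n} \<and> kernel n f \<noteq> max_pos n f}"
        using u kernel_trivial_iff[OF sk[OF u(1)] u(2)[unfolded I_def] n] I_sub by blast
    qed
    show "\<forall>f\<in>{f. f \<in> bijs {..<n} {..<n} \<and> kernel n f \<noteq> max_pos n f} - (\<Union>u\<in>U. I u). wt {..<n} f $ r = 0"
    proof
      fix f assume "f \<in> {f. f \<in> bijs {..<n} {..<n} \<and> kernel n f \<noteq> max_pos n f} - (\<Union>u\<in>U. I u)"
      then have f: "f \<in> bijs {..<n} {..<n}" "kernel n f \<noteq> max_pos n f" "f \<notin> (\<Union>u\<in>U. I u)" by auto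
      obtain m \<tau> \<nu> where s: "skeleton m \<tau> \<nu> n" "f \<in> inflation_set m \<tau> \<nu> n" "\<forall>i\<ge>m. \<nu> i = 0"
        using skeleton_exists[OF f(1) n] by blast
      have ne: "occs {..<m} \<tau> \<noteq> {}" using kernel_trivial_iff[OF s(1,2) n] f(2) by simp
      define X where "X = Abs_multiset \<nu>"
      have X: "count X = \<nu>" unfolding X_def
      proof (rule count_Abs_multiset)
        have "x < m" if "\<nu> x > 0" for x using s(3) that by (metis less_irrefl not_less)
        then have "{x. \<nu> x > 0} \<subseteq> {..<m}" by blast
        then show "finite {x. \<nu> x > 0}" by (rule finite_subset) simp
      qed
      have sub: "set_mset X \<subseteq> {..<m}"
      proof
        fix i assume "i \<in># X"
        then show "i \<in> {..<m}" using s(3) X by (metis count_greater_zero_iff lessThan_iff less_irrefl not_less)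
      qed
      have "i \<in># X \<longleftrightarrow> \<nu> i > 0" for i by (simp flip: X)
      then have "X \<in> block_sizes m \<tau> n"
        using s(1) sub size_eq_sum_count[OF sub]
        by (auto simp: block_sizes_def multisets_of_size_def X skeleton_def)
      then have "((m, \<tau>), X) \<in> U" if "card (occs {..<m} \<tau>) \<le> r"
        using s(1) ne that by (simp add: U_def patterns_def skeleton_def)
      moreover have "f \<in> I ((m, \<tau>), X)" using s(2) by (simp add: I_def X)
      ultimately have "card (occs {..<m} \<tau>) > r" using f(3) by (meson UN_I not_less)
      also have "card (occs {..<m} \<tau>) \<le> card (occs {..<n} f)"
      proof -
        interpret rigid_labels n m \<tau> "label \<nu>" "label (\<nu> \<circ> inv_into {..<m} \<tau>)" \<nu>
          using s(1) by (rule skeleton_rigid)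
        show ?thesis using card_occs_inflation[of f] s(2) by (simp add: inflation_set_def inflations_def)
      qed
      finally show "wt {..<n} f $ r = 0" by (rule wt_nth_eq_0)
    qed
  qed auto
  finally show ?thesis by simp
qed

section \<open>Permutations whose kernel is the maximum alone\<close>

lemma trivial_kernelD:
  assumes f: "f \<in> bijs {..<n} {..<n}" and p: "Suc (f p) = n" "p < n" "kernel n f = {p}"
    and xy: "x < p" "p < y" "y < n"
  shows "f y < f x"
proof -
  have ne: "f y \<noteq> f x" "f y \<noteq> f p" using bijs_eq_iff[OF f] xy p(2) by auto
  have "f y < n" using bijs_less[OF f] xy by simp
  then have "f y < f p" using ne p(1) by linarith
  then have "(x, p, y) \<in> occs {..<n} f" if "f x < f y" using that xy p(2) by (simp add: occs_def)
  then have "\<not> f x < f y" using kernel_occ(1)[of x p y n f] p(3) xy by auto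
  then show ?thesis using ne(1) by linarith
qed

text \<open>The maximum can only be the largest point of an occurrence, and \<open>dec\<close>
  leaves no increasing pair on its two sides.\<close>

lemma trivial_kernelI:
  assumes p: "Suc (f p) = n" "p < n" and f: "f \<in> bijs {..<n} {..<n}"
    and dec: "\<And>x y. x < p \<Longrightarrow> p < y \<Longrightarrow> y < n \<Longrightarrow> f y < f x"
  shows "kernel n f = {p}" "max_pos n f = {p}"
proof -
  show M: "max_pos n f = {p}" using p bijs_eq_iff[OF f] by (auto simp: max_pos_def)
  have "x \<noteq> p \<and> y \<noteq> p \<and> z \<noteq> p" if o: "(x, y, z) \<in> occs {..<n} f" for x y z
  proof -
    have r: "x < y" "y < z" "y < n" "z < n" "f x < f z" "f z < f y" using o by (auto simp: occs_def)
    have "f y < n" "f z < n" using bijs_less[OF f] r by auto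
    then show ?thesis using r p(1) dec[of x z] by auto
  qed
  then have "occ_closed n f {p}" unfolding occ_closed_def by blast
  then have "kernel n f \<subseteq> {p}" using M p by (intro kernel_least) auto
  then show "kernel n f = {p}" using max_pos_in_kernel[of n f] M by auto
qed

text \<open>The kernel consists of the maximum alone iff the permutation is an inflation of 231, with
  possibly empty outer blocks.\<close>

lemma trivial_kernel_sum_at:
  assumes p: "p < n"
  shows "(\<Sum>f | f \<in> bijs {..<n} {..<n} \<and> kernel n f = {p} \<and> max_pos n f = {p}. wt {..<n} f) =
    (- 1) ^ (p * (n - 1 - p) + (n - 1 - p)) * (perm_sum p * perm_sum 1 * perm_sum (n - 1 - p))"
proof -
  define \<tau> :: "nat \<Rightarrow> nat" where "\<tau> = (\<lambda>i. if i = 0 then 1 else if i = 1 then 2 else 0)"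
  define l :: "nat \<Rightarrow> nat" where "l = (\<lambda>x. if x < p then 0 else if x = p then 1 else 2)"
  define l' :: "nat \<Rightarrow> nat" where "l' = (\<lambda>y. if y < n - 1 - p then 0 else if y < n - 1 then 1 else 2)"
  define \<nu> :: "nat \<Rightarrow> nat" where "\<nu> = (\<lambda>i. if i = 0 then p else if i = 1 then 1 else n - 1 - p)"
  have three: "i < 3 \<longleftrightarrow> i = 0 \<or> i = 1 \<or> i = 2" for i :: nat by auto
  have 3: "{..<3::nat} = {0, 1, 2}" by auto
  \<comment> \<open>With block sizes p, 1, n - 1 - p these two inversions produce the two summands
    of the exponent in the statement.\<close>
  have inv: "invs {..<3} \<tau> = {(0, 2), (1, 2)}"
    unfolding 3 by (auto simp: invs_def \<tau>_def)
  have occ: "occs {..<3} \<tau> = {}"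
    unfolding 3 by (auto simp: occs_def \<tau>_def)
  interpret rigid_labels n 3 \<tau> l l' \<nu>
  proof
    show "bij_betw \<tau> {..<3} {..<3}" unfolding 3 by (auto simp: bij_betw_def \<tau>_def)
    show "card {x \<in> {..<n}. l x = i} = \<nu> i" if "i < 3" for i
    proof -
      have "{x \<in> {..<n}. l x = 0} = {..<p}" "{x \<in> {..<n}. l x = 1} = {p}"
        "{x \<in> {..<n}. l x = 2} = {p<..<n}"
        using p by (auto simp: l_def)
      then show ?thesis using that unfolding three by (elim disjE) (simp_all add: \<nu>_def)
    qed
    show "card {y \<in> {..<n}. l' y = \<tau> i} = \<nu> i" if "i < 3" for i
    proof -
      have "{y \<in> {..<n}. l' y = 1} = {n - 1 - p..<n - 1}" "{y \<in> {..<n}. l' y = 2} = {n - 1}"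
        "{y \<in> {..<n}. l' y = 0} = {..<n - 1 - p}"
        using p by (auto simp: l'_def split: if_splits)
      then show ?thesis using that p unfolding three by (elim disjE) (simp_all add: \<nu>_def \<tau>_def)
    qed
    show "\<nu> j \<le> 1" if "i < j" "j < 3" "\<tau> i < \<tau> j" for i j
      using that by (auto simp: three \<tau>_def \<nu>_def split: if_splits)
  qed (auto simp: l_def l'_def occ)
  have "inflations = {f. f \<in> bijs {..<n} {..<n} \<and> kernel n f = {p} \<and> max_pos n f = {p}}"
  proof (intro equalityI subsetI)
    fix f assume f: "f \<in> inflations"
    then have b: "f \<in> bijs {..<n} {..<n}" by (simp add: inflations_def)
    have "l' (f p) = 2" using inflation_label[OF f p] by (simp add: l_def \<tau>_def)
    then have fp: "Suc (f p) = n" using inflation_less[OF f p] by (auto simp: l'_def split: if_splits)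
    have "f y < f x" if "x < p" "p < y" "y < n" for x y
      by (rule inflation_less_of_label[OF f]) (use that in \<open>auto simp: l_def \<tau>_def\<close>)
    then show "f \<in> {f. f \<in> bijs {..<n} {..<n} \<and> kernel n f = {p} \<and> max_pos n f = {p}}"
      using trivial_kernelI[OF fp p b] b by auto
  next
    fix f assume "f \<in> {f. f \<in> bijs {..<n} {..<n} \<and> kernel n f = {p} \<and> max_pos n f = {p}}"
    then have b: "f \<in> bijs {..<n} {..<n}" and K: "kernel n f = {p}" and "p \<in> max_pos n f" by auto
    then have fp: "Suc (f p) = n" by (simp add: max_pos_def)
    have inj: "inj_on f A" if "A \<subseteq> {..<n}" for A
      using b that by (auto simp: bijs_def bij_betw_def intro: inj_on_subset)
    have le: "f x < n - 1" if "x < n" "x \<noteq> p" for x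
      using bijs_less[OF b that(1)] bijs_eq_iff[OF b that(1) p] that(2) fp by auto
    \<comment> \<open>All n - 1 - p values to the right of the maximum lie below
      \<open>f x\<close>.\<close>
    have left: "n - 1 - p \<le> f x" if x: "x < p" for x
    proof -
      have "f ` {p<..<n} \<subseteq> {..<f x}" using trivial_kernelD[OF b fp p K x] by auto
      then have "card (f ` {p<..<n}) \<le> card {..<f x}" by (intro card_mono) auto
      moreover have "inj_on f {p<..<n}" by (rule inj) auto
      ultimately show ?thesis by (simp add: card_image)
    qed
    have right: "f y < n - 1 - p" if y: "p < y" "y < n" for y
    proof -
      have "f ` {..<p} \<subseteq> {f y<..<n - 1}"
        using trivial_kernelD[OF b fp p K _ y] le y by auto
      then have "card (f ` {..<p}) \<le> card {f y<..<n - 1}" by (intro card_mono) auto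
      moreover have "inj_on f {..<p}" by (rule inj) (use p in auto)
      ultimately have "p \<le> n - 1 - Suc (f y)" by (simp add: card_image)
      \<comment> \<open>For p = 0 the count is vacuous because of truncated subtraction; then
        \<open>f y < n - 1\<close> is already the claim.\<close>
      then show ?thesis using le[of y] y p by (cases "p = 0") auto
    qed
    have "l' (f x) = \<tau> (l x)" if x: "x < n" for x
    proof -
      consider "x < p" | "x = p" | "p < x" by linarith
      then show ?thesis
      proof cases
        case 1 then show ?thesis using left[of x] le[of x] x by (simp add: l'_def l_def \<tau>_def)
      next
        case 2 then show ?thesis using fp p by (auto simp add: l'_def l_def \<tau>_def)
      next
        case 3 then show ?thesis using right[of x] x by (simp add: l'_def l_def \<tau>_def)
      qed
    qed
    then show "f \<in> inflations" using b by (simp add: inflations_def)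
  qed
  then show ?thesis
    using sum_wt_inflations[unfolded inv occ] unfolding 3 by (simp add: \<nu>_def mult.assoc)
qed

lemma perm_sum_0: "perm_sum 0 = 1"
proof -
  have "bijs {..<0} {..<0} = {\<lambda>_. undefined}" by (auto simp: bijs_def bij_betw_def)
  moreover have "wt A f = 1" if "invs A f = {}" "occs A f = {}" for A f
    using that by (simp add: wt_def)
  ultimately show ?thesis by (simp add: perm_sum_def invs_def occs_def)
qed

lemma perm_sum_1: "perm_sum 1 = 1"
proof -
  have "bijs {..<1} {..<1} = {\<lambda>x\<in>{0}. 0}"
    by (auto simp: bijs_def bij_betw_def extensional_def fun_eq_iff lessThan_Suc)
  moreover have "wt A f = 1" if "invs A f = {}" "occs A f = {}" for A f
    using that by (simp add: wt_def)
  ultimately show ?thesis by (simp add: perm_sum_def invs_def occs_def)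
qed

lemma trivial_kernel_sum:
  assumes n: "n > 0"
  shows "(\<Sum>f | f \<in> bijs {..<n} {..<n} \<and> kernel n f = max_pos n f. wt {..<n} f) =
    (\<Sum>p<n. (- 1) ^ (p * (n - 1 - p) + (n - 1 - p)) * (perm_sum p * perm_sum (n - 1 - p)))"
proof -
  let ?T = "\<lambda>p. {f. f \<in> bijs {..<n} {..<n} \<and> kernel n f = {p} \<and> max_pos n f = {p}}"
  have "{f. f \<in> bijs {..<n} {..<n} \<and> kernel n f = max_pos n f} = (\<Union>p<n. ?T p)"
  proof (intro equalityI subsetI)
    fix f assume f: "f \<in> {f. f \<in> bijs {..<n} {..<n} \<and> kernel n f = max_pos n f}"
    then obtain p where "p < n" "max_pos n f = {p}" using ex_max_pos[OF _ n, of f] by blast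
    then show "f \<in> (\<Union>p<n. ?T p)" using f by simp
  qed auto
  then have "(\<Sum>f | f \<in> bijs {..<n} {..<n} \<and> kernel n f = max_pos n f. wt {..<n} f) =
      (\<Sum>p<n. \<Sum>f\<in>?T p. wt {..<n} f)"
    by (simp only:) (intro sum.UNION_disjoint, auto)
  then show ?thesis using trivial_kernel_sum_at[of _ n] by (simp add: perm_sum_1[simplified])
qed

theorem perm_sum_recurrence:
  assumes n: "n > 0"
  shows "perm_sum n $ r =
    (\<Sum>p<n. (- 1) ^ (p * (n - 1 - p) + (n - 1 - p)) * (perm_sum p * perm_sum (n - 1 - p))) $ r +
    (\<Sum>(m, \<tau>)\<in>patterns r. \<Sum>X\<in>block_sizes m \<tau> n.
      ((- 1) ^ (\<Sum>(i, j)\<in>invs {..<m} \<tau>. count X i * count X j) * fps_X ^ card (occs {..<m} \<tau>) *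
        (\<Prod>i<m. perm_sum (count X i))) $ r)"
proof -
  have "perm_sum n $ r = (\<Sum>f\<in>bijs {..<n} {..<n}. wt {..<n} f $ r)"
    by (simp add: perm_sum_def fps_sum_nth)
  also have "\<dots> = (\<Sum>f | f \<in> bijs {..<n} {..<n} \<and> kernel n f = max_pos n f. wt {..<n} f $ r) +
      (\<Sum>f | f \<in> bijs {..<n} {..<n} \<and> kernel n f \<noteq> max_pos n f. wt {..<n} f $ r)"
    by (subst sum.union_disjoint[symmetric]) (auto intro!: sum.cong)
  also have "(\<Sum>f | f \<in> bijs {..<n} {..<n} \<and> kernel n f = max_pos n f. wt {..<n} f $ r) =
      (\<Sum>p<n. (- 1) ^ (p * (n - 1 - p) + (n - 1 - p)) * (perm_sum p * perm_sum (n - 1 - p))) $ r"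
    by (simp only: trivial_kernel_sum[OF n, symmetric] fps_sum_nth)
  also have "(\<Sum>f | f \<in> bijs {..<n} {..<n} \<and> kernel n f \<noteq> max_pos n f. wt {..<n} f $ r) =
    (\<Sum>(m, \<tau>)\<in>patterns r. \<Sum>X\<in>block_sizes m \<tau> n.
      ((- 1) ^ (\<Sum>(i, j)\<in>invs {..<m} \<tau>. count X i * count X j) * fps_X ^ card (occs {..<m} \<tau>) *
        (\<Prod>i<m. perm_sum (count X i))) $ r)"
    unfolding nontrivial_kernel_sum[OF n]
    by (intro sum.cong refl) (auto intro!: sum.cong simp: inflation_sum[OF skeleton_block_sizes])
  finally show ?thesis .
qed

section \<open>Generating functions\<close>

lemma eval2_pCons: "eval2 (pCons a P) s = fps_to_fls (fps_of_poly a) + s * eval2 P s"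
  by (simp add: eval2_def map_poly_pCons)

lemma eval2_0 [simp]: "eval2 0 s = 0"
  by (simp add: eval2_def)

lemma eval2_add: "eval2 (P + Q) s = eval2 P s + eval2 Q s"
  by (induction P Q rule: poly_induct2) (simp_all add: eval2_pCons fps_of_poly_add algebra_simps)

lemma eval2_smult: "eval2 (smult a P) s = fps_to_fls (fps_of_poly a) * eval2 P s"
  by (induction P) (simp_all add: eval2_pCons fps_of_poly_mult fls_times_fps_to_fls algebra_simps)

lemma eval2_mult: "eval2 (P * Q) s = eval2 P s * eval2 Q s"
  by (induction P) (simp_all add: eval2_pCons eval2_add eval2_smult algebra_simps)

lemma eval2_const: "eval2 [:a:] s = fps_to_fls (fps_of_poly a)"
  by (simp add: eval2_pCons)

lemma eval2_1 [simp]: "eval2 1 s = 1"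
  using eval2_const[of 1 s] by (simp add: pCons_one)

context
  fixes s :: "rat fls"
begin

lemma rational_functionsI: "eval2 Q s \<noteq> 0 \<Longrightarrow> x = eval2 P s / eval2 Q s \<Longrightarrow> x \<in> rational_functions_of_X_and s"
  by (auto simp: rational_functions_of_X_and_def)

lemma rational_functionsE:
  assumes "x \<in> rational_functions_of_X_and s"
  obtains P Q where "eval2 Q s \<noteq> 0" "x = eval2 P s / eval2 Q s"
  using assms by (auto simp: rational_functions_of_X_and_def)

lemma eval2_in: "eval2 P s \<in> rational_functions_of_X_and s"
  by (rule rational_functionsI[of 1 _ P]) simp_all

lemma rational_functions_fls_X: "fls_X \<in> rational_functions_of_X_and s"
  using eval2_in[of "[:[:0, 1:]:]"] by (simp add: eval2_const)

lemma rational_functions_s: "s \<in> rational_functions_of_X_and s"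
  using eval2_in[of "[:0, 1:]"] by (simp add: eval2_pCons)

lemma rational_functions_0: "0 \<in> rational_functions_of_X_and s" and rational_functions_1: "1 \<in> rational_functions_of_X_and s"
  using eval2_in[of 0] eval2_in[of 1] by simp_all

lemma rational_functions_add: "x \<in> rational_functions_of_X_and s \<Longrightarrow> y \<in> rational_functions_of_X_and s \<Longrightarrow> x + y \<in> rational_functions_of_X_and s"
proof (elim rational_functionsE)
  fix P Q P' Q' assume *: "eval2 Q s \<noteq> 0" "x = eval2 P s / eval2 Q s"
    "eval2 Q' s \<noteq> 0" "y = eval2 P' s / eval2 Q' s"
  then show ?thesis
    by (intro rational_functionsI[of "Q * Q'" _ "P * Q' + P' * Q"])
      (simp_all add: eval2_mult eval2_add add_frac_eq)
qed

lemma rational_functions_mult: "x \<in> rational_functions_of_X_and s \<Longrightarrow> y \<in> rational_functions_of_X_and s \<Longrightarrow> x * y \<in> rational_functions_of_X_and s"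
proof (elim rational_functionsE)
  fix P Q P' Q' assume *: "eval2 Q s \<noteq> 0" "x = eval2 P s / eval2 Q s"
    "eval2 Q' s \<noteq> 0" "y = eval2 P' s / eval2 Q' s"
  then show ?thesis
    by (intro rational_functionsI[of "Q * Q'" _ "P * P'"]) (simp_all add: eval2_mult)
qed

lemma rational_functions_divide: "x \<in> rational_functions_of_X_and s \<Longrightarrow> y \<in> rational_functions_of_X_and s \<Longrightarrow> x / y \<in> rational_functions_of_X_and s"
proof (elim rational_functionsE)
  fix P Q P' Q' assume *: "eval2 Q s \<noteq> 0" "x = eval2 P s / eval2 Q s"
    "eval2 Q' s \<noteq> 0" "y = eval2 P' s / eval2 Q' s"
  show ?thesis
  proof (cases "eval2 P' s = 0")
    case False
    then show ?thesis using *
      by (intro rational_functionsI[of "Q * P'" _ "P * Q'"]) (simp_all add: eval2_mult)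
  qed (use * rational_functions_0 in simp)
qed

lemma rational_functions_uminus: "x \<in> rational_functions_of_X_and s \<Longrightarrow> - x \<in> rational_functions_of_X_and s"
proof -
  have "eval2 (- 1) s = - 1" using eval2_add[of 1 "- 1" s] by (simp add: eq_neg_iff_add_eq_0 add.commute)
  then show "x \<in> rational_functions_of_X_and s \<Longrightarrow> - x \<in> rational_functions_of_X_and s" using rational_functions_mult[of "- 1" x] eval2_in[of "- 1"] by simp
qed

lemma rational_functions_diff: "x \<in> rational_functions_of_X_and s \<Longrightarrow> y \<in> rational_functions_of_X_and s \<Longrightarrow> x - y \<in> rational_functions_of_X_and s"
  using rational_functions_add[of x "- y"] rational_functions_uminus[of y] by simp

lemma rational_functions_sum: "(\<And>i. i \<in> A \<Longrightarrow> fps_to_fls (f i) \<in> rational_functions_of_X_and s) \<Longrightarrow> fps_to_fls (\<Sum>i\<in>A. f i) \<in> rational_functions_of_X_and s"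
  by (induction A rule: infinite_finite_induct) (auto intro: rational_functions_0 rational_functions_add)

end

text \<open>The coefficient of q^r, as a power series in x: in \<open>rat fps fps\<close> the outer
  variable is x and the inner one is q.\<close>

definition slice :: "nat \<Rightarrow> rat fps fps \<Rightarrow> rat fps" where
  "slice r F = Abs_fps (\<lambda>n. F $ n $ r)"

lemma slice_nth [simp]: "slice r F $ n = F $ n $ r"
  by (simp add: slice_def)

lemma slice_add: "slice r (F + H) = slice r F + slice r H"
  by (rule fps_ext) simp

lemma slice_1: "slice r 1 = (if r = 0 then 1 else 0)"
  by (rule fps_ext) simp

lemma slice_X: "slice r fps_X = (if r = 0 then fps_X else 0)"
  by (rule fps_ext) simp

lemma slice_mult: "slice r (F * H) = (\<Sum>i=0..r. slice i F * slice (r - i) H)"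
proof (rule fps_ext)
  fix n
  have "slice r (F * H) $ n = (\<Sum>k=0..n. \<Sum>i=0..r. F $ k $ i * H $ (n - k) $ (r - i))"
    by (simp add: fps_mult_nth fps_sum_nth)
  also have "\<dots> = (\<Sum>i=0..r. \<Sum>k=0..n. F $ k $ i * H $ (n - k) $ (r - i))"
    by (rule sum.swap)
  finally show "slice r (F * H) $ n = (\<Sum>i=0..r. slice i F * slice (r - i) H) $ n"
    by (simp add: fps_mult_nth fps_sum_nth)
qed

lemma slice_X_mult: "slice r (fps_X * F) = fps_X * slice r F"
  by (rule fps_ext) simp

lemma slice_const_mult: "slice r (fps_const (fps_X ^ c) * F) = (if r < c then 0 else slice (r - c) F)"
  by (rule fps_ext) (simp add: fps_X_power_mult_nth)

text \<open>Splitting by the parity of the size turns the signs of inversions between blocks into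
  constants.\<close>

definition parity_series :: "bool \<Rightarrow> rat fps fps" where
  "parity_series b = Abs_fps (\<lambda>n. if odd n = b then perm_sum n else 0)"

text \<open>A kernel block is a single point and contributes x, of odd size. Any other block is
  nonempty, so the constant term 1 of the even series is removed.\<close>

definition block_series :: "nat \<Rightarrow> (nat \<Rightarrow> nat) \<Rightarrow> nat \<Rightarrow> bool \<Rightarrow> rat fps fps" where
  "block_series m \<tau> i b =
    (if i \<in> kernel m \<tau> then (if b then fps_X else 0) else parity_series b - (if b then 0 else 1))"

definition pattern_series :: "nat \<Rightarrow> (nat \<Rightarrow> nat) \<Rightarrow> nat set \<Rightarrow> rat fps fps" where
  "pattern_series m \<tau> S = fps_const (fps_X ^ card (occs {..<m} \<tau>)) * (\<Prod>i<m. block_series m \<tau> i (i \<in> S))"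

text \<open>\<open>S\<close> is the set of blocks of odd size: it fixes the sign, since a product of
  two sizes is odd only if both lie in \<open>S\<close>, and its cardinality has the parity
  \<open>b\<close> of the total size.\<close>

definition nontrivial_series :: "nat \<Rightarrow> bool \<Rightarrow> rat fps" where
  "nontrivial_series r b = (\<Sum>(m, \<tau>)\<in>patterns r. \<Sum>S | S \<subseteq> {..<m} \<and> odd (card S) = b.
    (- 1) ^ (\<Sum>(i, j)\<in>invs {..<m} \<tau>. of_bool (i \<in> S \<and> j \<in> S)) * slice r (pattern_series m \<tau> S))"

lemma block_series_nth:
  "block_series m \<tau> i b $ n =
    (if odd n = b \<and> n > 0 \<and> (i \<in> kernel m \<tau> \<longrightarrow> n = 1) then perm_sum n else 0)"
  using perm_sum_0 perm_sum_1 by (auto simp: block_series_def parity_series_def)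

text \<open>\<open>block_series\<close> vanishes at sizes that are 0, have the wrong parity or
  differ from 1 on the kernel, so among all multisets only the admissible ones with odd set
  \<open>S\<close> survive.\<close>

lemma pattern_series_nth:
  assumes S: "S \<subseteq> {..<m}"
  shows "pattern_series m \<tau> S $ n = fps_X ^ card (occs {..<m} \<tau>) *
    (\<Sum>X\<in>block_sizes m \<tau> n. if S = {i \<in> {..<m}. odd (count X i)} then \<Prod>i<m. perm_sum (count X i) else 0)"
proof -
  have "(\<Prod>i<m. block_series m \<tau> i (i \<in> S)) $ n =
      (\<Sum>X\<in>multisets_of_size {..<m} n. \<Prod>i<m. block_series m \<tau> i (i \<in> S) $ count X i)"
    by (rule fps_prod_nth') simp
  also have "\<dots> = (\<Sum>X\<in>multisets_of_size {..<m} n. if X \<in> block_sizes m \<tau> n then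
      (if S = {i \<in> {..<m}. odd (count X i)} then \<Prod>i<m. perm_sum (count X i) else 0) else 0)"
  proof (rule sum.cong[OF refl])
    fix X assume X: "X \<in> multisets_of_size {..<m} n"
    let ?P = "\<lambda>i. odd (count X i) = (i \<in> S) \<and> count X i > 0 \<and> (i \<in> kernel m \<tau> \<longrightarrow> count X i = 1)"
    have iff: "(\<forall>i<m. ?P i) \<longleftrightarrow> X \<in> block_sizes m \<tau> n \<and> S = {i \<in> {..<m}. odd (count X i)}"
    proof
      assume P: "\<forall>i<m. ?P i"
      then have "S = {i \<in> {..<m}. odd (count X i)}" using S by blast
      moreover have "\<forall>i\<in>kernel m \<tau>. count X i = 1" using P kernel_less by blast
      ultimately show "X \<in> block_sizes m \<tau> n \<and> S = {i \<in> {..<m}. odd (count X i)}"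
        using P X by (simp add: block_sizes_def)
    qed (auto simp: block_sizes_def)
    have nest: "(if A then if B then t else 0 else 0) = (if A \<and> B then t else 0)"
      for A B and t :: "rat fps" by simp
    show "(\<Prod>i<m. block_series m \<tau> i (i \<in> S) $ count X i) = (if X \<in> block_sizes m \<tau> n then
      (if S = {i \<in> {..<m}. odd (count X i)} then \<Prod>i<m. perm_sum (count X i) else 0) else 0)"
      unfolding nest iff[symmetric]
    proof (cases "\<forall>i<m. ?P i")
      case True
      then have "(\<Prod>i<m. block_series m \<tau> i (i \<in> S) $ count X i) = (\<Prod>i<m. perm_sum (count X i))"
        unfolding block_series_nth by (intro prod.cong refl if_P) auto
      then show "(\<Prod>i<m. block_series m \<tau> i (i \<in> S) $ count X i) =
          (if \<forall>i<m. ?P i then \<Prod>i<m. perm_sum (count X i) else 0)"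
        by (simp only: if_P[OF True])
    next
      case False
      then have "(\<Prod>i<m. block_series m \<tau> i (i \<in> S) $ count X i) = 0"
        unfolding block_series_nth by (intro prod_zero) auto
      then show "(\<Prod>i<m. block_series m \<tau> i (i \<in> S) $ count X i) =
          (if \<forall>i<m. ?P i then \<Prod>i<m. perm_sum (count X i) else 0)"
        by (simp only: if_not_P[OF False])
    qed
  qed
  also have "\<dots> = (\<Sum>X\<in>block_sizes m \<tau> n. if S = {i \<in> {..<m}. odd (count X i)} then \<Prod>i<m. perm_sum (count X i) else 0)"
    by (rule sum.mono_neutral_cong_right) (auto simp: block_sizes_def)
  finally show ?thesis by (simp add: pattern_series_def)
qed

lemma nontrivial_series_nth:
  "nontrivial_series r b $ n = (if odd n = b then
    (\<Sum>(m, \<tau>)\<in>patterns r. \<Sum>X\<in>block_sizes m \<tau> n.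
      ((- 1) ^ (\<Sum>(i, j)\<in>invs {..<m} \<tau>. count X i * count X j) * fps_X ^ card (occs {..<m} \<tau>) *
        (\<Prod>i<m. perm_sum (count X i))) $ r) else 0)"
proof -
  define e where "e = (\<lambda>m \<tau> (S :: nat set). \<Sum>(i, j)\<in>invs {..<m} \<tau>. of_bool (i \<in> S \<and> j \<in> S) :: nat)"
  define w :: "nat \<Rightarrow> (nat \<Rightarrow> nat) \<Rightarrow> nat multiset \<Rightarrow> rat fps" where
    "w = (\<lambda>m \<tau> X. fps_X ^ card (occs {..<m} \<tau>) * (\<Prod>i<m. perm_sum (count X i)))"
  define od where "od = (\<lambda>m X. {i \<in> {..<m :: nat}. odd (count X i)})"
  have sgn: "(- 1 :: rat fps) ^ (\<Sum>(i, j)\<in>invs {..<m} \<tau>. count X i * count X j) = (- 1) ^ e m \<tau> (od m X)"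
    for m \<tau> X
    unfolding e_def power_sum
    by (intro prod.cong refl) (auto simp: od_def invs_def minus_one_power_iff)
  have par: "odd (card (od m X)) = odd n" if "X \<in> block_sizes m \<tau> n" for m \<tau> X
  proof -
    have "set_mset X \<subseteq> {..<m}" "size X = n" using that by (auto simp: block_sizes_def multisets_of_size_def)
    then have "n = (\<Sum>i<m. count X i)" using size_eq_sum_count by metis
    then show ?thesis using even_sum_iff[of "{..<m}" "count X"] by (simp add: od_def)
  qed
  have sgn_nth: "((- 1) ^ k * f) $ i = (- 1) ^ k * f $ i" for k i and f :: "rat fps"
    by (cases "even k") auto
  have "nontrivial_series r b $ n = (\<Sum>(m, \<tau>)\<in>patterns r. \<Sum>S | S \<subseteq> {..<m} \<and> odd (card S) = b.
      (- 1) ^ e m \<tau> S * pattern_series m \<tau> S $ n $ r)"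
    by (simp add: nontrivial_series_def e_def fps_sum_nth case_prod_unfold sgn_nth)
  also have "\<dots> = (\<Sum>(m, \<tau>)\<in>patterns r. \<Sum>S | S \<subseteq> {..<m} \<and> odd (card S) = b. \<Sum>X\<in>block_sizes m \<tau> n.
      if od m X = S then ((- 1) ^ e m \<tau> S * w m \<tau> X) $ r else 0)"
  proof (intro sum.cong refl, clarify, intro sum.cong refl)
    fix m :: nat and \<tau> S assume "S \<in> {S. S \<subseteq> {..<m} \<and> odd (card S) = b}"
    then have "pattern_series m \<tau> S $ n = (\<Sum>X\<in>block_sizes m \<tau> n. if od m X = S then w m \<tau> X else 0)"
    proof -
      assume "S \<in> {S. S \<subseteq> {..<m} \<and> odd (card S) = b}"
      then have "S \<subseteq> {..<m}" by simp
      moreover have "{i \<in> {..<m}. odd (count X i)} = od m X" for X by (simp add: od_def)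
      ultimately show ?thesis
        unfolding pattern_series_nth[OF \<open>S \<subseteq> {..<m}\<close>] sum_distrib_left
        by (intro sum.cong refl) (simp only: w_def eq_commute[of S], simp)
    qed
    then show "(- 1) ^ e m \<tau> S * pattern_series m \<tau> S $ n $ r = (\<Sum>X\<in>block_sizes m \<tau> n.
        if od m X = S then ((- 1) ^ e m \<tau> S * w m \<tau> X) $ r else 0)"
      by (simp add: fps_sum_nth sum_distrib_left) (intro sum.cong refl, simp add: sgn_nth)
  qed
  also have "\<dots> = (\<Sum>(m, \<tau>)\<in>patterns r. \<Sum>X\<in>block_sizes m \<tau> n.
      if odd n = b then ((- 1) ^ e m \<tau> (od m X) * w m \<tau> X) $ r else 0)"
  proof (intro sum.cong refl, clarify)
    fix m :: nat and \<tau>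
    have fin: "finite {S. S \<subseteq> {..<m} \<and> odd (card S) = b}"
      by (rule finite_subset[of _ "Pow {..<m}"]) auto
    have "(\<Sum>S | S \<subseteq> {..<m} \<and> odd (card S) = b. \<Sum>X\<in>block_sizes m \<tau> n.
        if od m X = S then ((- 1) ^ e m \<tau> S * w m \<tau> X) $ r else 0) =
      (\<Sum>X\<in>block_sizes m \<tau> n. \<Sum>S | S \<subseteq> {..<m} \<and> odd (card S) = b.
        if od m X = S then ((- 1) ^ e m \<tau> S * w m \<tau> X) $ r else 0)"
      by (rule sum.swap)
    also have "\<dots> = (\<Sum>X\<in>block_sizes m \<tau> n.
        if odd n = b then ((- 1) ^ e m \<tau> (od m X) * w m \<tau> X) $ r else 0)"
    proof (rule sum.cong[OF refl])
      fix X assume "X \<in> block_sizes m \<tau> n"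
      moreover have "od m X \<subseteq> {..<m}" by (auto simp: od_def)
      ultimately show "(\<Sum>S | S \<subseteq> {..<m} \<and> odd (card S) = b.
          if od m X = S then ((- 1) ^ e m \<tau> S * w m \<tau> X) $ r else 0) =
        (if odd n = b then ((- 1) ^ e m \<tau> (od m X) * w m \<tau> X) $ r else 0)"
        \<comment> \<open>Each choice of sizes is counted for exactly one \<open>S\<close>, its own
          set of odd blocks, whose cardinality has the parity of \<open>n\<close>.\<close>
        using fin par by (subst sum.delta') auto
    qed
    finally show "(\<Sum>S | S \<subseteq> {..<m} \<and> odd (card S) = b. \<Sum>X\<in>block_sizes m \<tau> n.
        if od m X = S then ((- 1) ^ e m \<tau> S * w m \<tau> X) $ r else 0) =
      (\<Sum>X\<in>block_sizes m \<tau> n. if odd n = b then ((- 1) ^ e m \<tau> (od m X) * w m \<tau> X) $ r else 0)" .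
  qed
  finally show ?thesis by (simp add: sgn w_def mult.assoc)
qed

lemma parity_series_square_nth: "odd n \<Longrightarrow> (parity_series b ^ 2) $ n = 0"
  by (auto simp: power2_eq_square fps_mult_nth parity_series_def intro!: sum.neutral)

text \<open>Write q = n - 1 - p; the exponent is q * (p + 1). For odd \<open>n\<close> the sizes p
  and q have equal parity and every sign is +, which leaves the even-even and odd-odd products. For
  even \<open>n\<close> the parities differ, and exchanging p and q reverses the sign, so everything
  cancels.\<close>

lemma sum_signed_products:
  "(\<Sum>p<n. (- 1) ^ (p * (n - 1 - p) + (n - 1 - p)) * (perm_sum p * perm_sum (n - 1 - p))) =
    (fps_X * (parity_series False ^ 2 + parity_series True ^ 2)) $ n"
proof (cases "odd n")
  case True
  then obtain k where k: "n = Suc k" by (cases n) auto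
  then have "even k" using True by simp
  have "(\<Sum>p<n. (- 1) ^ (p * (n - 1 - p) + (n - 1 - p)) * (perm_sum p * perm_sum (n - 1 - p))) =
    (\<Sum>p=0..k. parity_series False $ p * parity_series False $ (k - p) +
      parity_series True $ p * parity_series True $ (k - p))"
    using \<open>even k\<close> k
    by (intro sum.cong) (auto simp: parity_series_def less_Suc_eq_le)
  also have "\<dots> = (parity_series False ^ 2 + parity_series True ^ 2) $ k"
    by (simp add: power2_eq_square fps_mult_nth sum.distrib)
  also have "\<dots> = (fps_X * (parity_series False ^ 2 + parity_series True ^ 2)) $ n"
    by (simp add: k)
  finally show ?thesis .
next
  case False
  let ?t = "\<lambda>p. (- 1) ^ (p * (n - 1 - p) + (n - 1 - p)) * (perm_sum p * perm_sum (n - 1 - p))"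
  have "(\<Sum>p<n. ?t p) = (\<Sum>p<n. - ?t p)"
  proof (rule sum.reindex_bij_witness[where i = "\<lambda>p. n - 1 - p" and j = "\<lambda>p. n - 1 - p"])
    fix p assume p: "p \<in> {..<n}"
    then have "odd p = even (n - 1 - p)" using False by (auto simp: even_diff_nat)
    moreover have "n - 1 - (n - 1 - p) = p" using p by auto
    ultimately show "- ?t (n - 1 - p) = ?t p" by (cases "even p") (simp_all add: mult.commute)
  qed auto
  then have neg: "(\<Sum>p<n. ?t p) = - (\<Sum>p<n. ?t p)" by (simp only: sum_negf)
  have "T = 0" if "T = - T" for T :: "rat fps"
  proof (rule fps_ext)
    fix i show "T $ i = 0 $ i" using arg_cong[OF that, of "\<lambda>F. F $ i"] by simp
  qed
  from this[OF neg] have "(\<Sum>p<n. ?t p) = 0" .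
  moreover have "(fps_X * (parity_series False ^ 2 + parity_series True ^ 2)) $ n = 0"
    using False by (auto simp: parity_series_square_nth)
  ultimately show ?thesis by simp
qed

section \<open>Functional equations for the even and odd parts, and the square root\<close>

lemma perm_sum_recurrence':
  assumes "n > 0"
  shows "perm_sum n $ r =
      (fps_X * slice r (parity_series False ^ 2 + parity_series True ^ 2)) $ n +
    nontrivial_series r (odd n) $ n"
  using perm_sum_recurrence[OF assms, of r]
  unfolding sum_signed_products nontrivial_series_nth slice_X_mult[symmetric] by simp

lemma nontrivial_series_0: "nontrivial_series r b $ 0 = 0"
proof -
  have "block_sizes m \<tau> 0 = {}" if "(m, \<tau>) \<in> patterns r" for m \<tau>
    using that by (auto simp: patterns_def block_sizes_def occs_def)
  then show ?thesis by (auto simp: nontrivial_series_nth intro!: sum.neutral)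
qed

lemma X_squares_nth:
  "even n \<Longrightarrow> (fps_X * slice r (parity_series False ^ 2 + parity_series True ^ 2)) $ n = 0"
  by (auto simp: parity_series_square_nth)

lemma slice_parity_nth: "slice r (parity_series b) $ n = (if odd n = b then perm_sum n $ r else 0)"
  by (simp add: parity_series_def)

text \<open>Trivial kernels contribute only to odd sizes; the summand \<open>slice r 1\<close> is
  the empty permutation, to which the recurrence does not apply.\<close>

lemma slice_even: "slice r (parity_series False) = slice r 1 + nontrivial_series r False"
proof (rule fps_ext)
  fix n show "slice r (parity_series False) $ n = (slice r 1 + nontrivial_series r False) $ n"
  proof (cases "n = 0")
    case True
    then show ?thesis by (simp add: parity_series_def perm_sum_0 nontrivial_series_0)
  next
    case False
    then show ?thesis
      using perm_sum_recurrence'[of n r] X_squares_nth[of n r]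
      by (cases "odd n") (simp_all only: slice_parity_nth, simp_all add: nontrivial_series_nth)
  qed
qed

lemma slice_odd: "slice r (parity_series True) =
  fps_X * slice r (parity_series False ^ 2 + parity_series True ^ 2) + nontrivial_series r True"
proof (rule fps_ext)
  fix n show "slice r (parity_series True) $ n =
    (fps_X * slice r (parity_series False ^ 2 + parity_series True ^ 2) + nontrivial_series r True) $ n"
  proof (cases "n = 0")
    case True
    then show ?thesis by (simp add: parity_series_def nontrivial_series_0)
  next
    case False
    then show ?thesis
      using perm_sum_recurrence'[of n r] X_squares_nth[of n r]
      by (cases "odd n") (simp_all only: slice_parity_nth, simp_all add: nontrivial_series_nth)
  qed
qed

lemma M_eq: "M r = slice r (parity_series False) + slice r (parity_series True)"
  by (rule fps_ext) (simp add: M_nth parity_series_def)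

lemma patterns_0: "patterns 0 = {}"
  by (auto simp: patterns_def)

lemma nontrivial_series_r0: "nontrivial_series 0 b = 0"
  by (simp add: nontrivial_series_def patterns_0)

lemma slice_0_even: "slice 0 (parity_series False) = 1"
  by (simp add: slice_even nontrivial_series_r0 slice_1)

text \<open>At r = 0 the even part is 1, so the odd part o satisfies o = x (1 + o^2); completing the
  square identifies 1 - 2 x o as the root with constant term 1.\<close>

lemma sqrt_eq: "sqrt_series = 1 - 2 * fps_X * slice 0 (parity_series True)"
proof (rule sqrt_series_unique[symmetric])
  let ?o = "slice 0 (parity_series True)"
  have "?o = fps_X * (1 + ?o ^ 2)"
    using slice_odd[of 0] by (simp add: nontrivial_series_r0 slice_add slice_mult power2_eq_square slice_0_even)
  then have "(1 - 2 * fps_X * ?o) ^ 2 = 1 - 4 * fps_X * (?o - fps_X * ?o ^ 2)"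
    by (simp add: power2_eq_square algebra_simps)
  also have "?o - fps_X * ?o ^ 2 = fps_X"
    using \<open>?o = fps_X * (1 + ?o ^ 2)\<close> by (simp add: algebra_simps)
  finally show "(1 - 2 * fps_X * ?o) ^ 2 = 1 - 4 * fps_X ^ 2" by (simp add: power2_eq_square mult.assoc)
qed simp

abbreviation (input) "in_Q_sqrt f \<equiv> fps_to_fls f \<in> rational_functions_of_X_and (fps_to_fls sqrt_series)"

lemma in_Q_sqrt_add: "in_Q_sqrt f \<Longrightarrow> in_Q_sqrt g \<Longrightarrow> in_Q_sqrt (f + g)"
  by (simp add: rational_functions_add)

lemma in_Q_sqrt_diff: "in_Q_sqrt f \<Longrightarrow> in_Q_sqrt g \<Longrightarrow> in_Q_sqrt (f - g)"
  by (simp add: rational_functions_diff)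

lemma in_Q_sqrt_mult: "in_Q_sqrt f \<Longrightarrow> in_Q_sqrt g \<Longrightarrow> in_Q_sqrt (f * g)"
  by (simp add: rational_functions_mult fls_times_fps_to_fls)

lemma in_Q_sqrt_0: "in_Q_sqrt 0" and in_Q_sqrt_1: "in_Q_sqrt 1" and in_Q_sqrt_X: "in_Q_sqrt fps_X"
  and in_Q_sqrt_sqrt: "in_Q_sqrt sqrt_series"
  by (simp_all add: rational_functions_0 rational_functions_1 rational_functions_fls_X rational_functions_s)

lemma in_Q_sqrt_cancel:
  assumes "in_Q_sqrt (g * f)" "in_Q_sqrt g" "g \<noteq> 0"
  shows "in_Q_sqrt f"
proof -
  have "fps_to_fls f = fps_to_fls (g * f) / fps_to_fls g"
    using assms(3) by (simp add: fls_times_fps_to_fls)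
  then show ?thesis using rational_functions_divide[OF assms(1,2)] by simp
qed

lemma in_Q_sqrt_sign: "in_Q_sqrt f \<Longrightarrow> in_Q_sqrt ((- 1) ^ k * f)"
  using in_Q_sqrt_diff[OF in_Q_sqrt_0, of f] by (cases "even k") auto

lemma in_Q_sqrt_slices_mult:
  assumes "\<And>i. i \<le> r \<Longrightarrow> in_Q_sqrt (slice i F)" "\<And>i. i \<le> r \<Longrightarrow> in_Q_sqrt (slice i H)" "i \<le> r"
  shows "in_Q_sqrt (slice i (F * H))"
  unfolding slice_mult using assms by (intro rational_functions_sum in_Q_sqrt_mult) auto

lemma in_Q_sqrt_slices_prod:
  assumes "\<And>x i. x \<in> A \<Longrightarrow> i \<le> r \<Longrightarrow> in_Q_sqrt (slice i (F x))" "i \<le> r"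
  shows "in_Q_sqrt (slice i (\<Prod>x\<in>A. F x))"
  using assms
proof (induction A arbitrary: i rule: infinite_finite_induct)
  case (insert x A)
  then show ?case by (simp del: fps_to_fls_plus) (rule in_Q_sqrt_slices_mult[of r], auto)
qed (auto simp: slice_1 intro: rational_functions_0 rational_functions_1)

text \<open>Every pattern uses up c > 0 occurrences, so its blocks enter only through slices of
  index at most r - c, which the induction hypothesis covers.\<close>

lemma in_Q_sqrt_nontrivial:
  assumes IH: "\<And>i b. i < r \<Longrightarrow> in_Q_sqrt (slice i (parity_series b))"
  shows "in_Q_sqrt (nontrivial_series r b)"
  unfolding nontrivial_series_def
proof (intro rational_functions_sum, clarify, intro rational_functions_sum in_Q_sqrt_sign)
  fix m \<tau> S assume p: "(m, \<tau>) \<in> patterns r"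
  let ?c = "card (occs {..<m} \<tau>)"
  have c: "?c > 0" "?c \<le> r" using p by (auto simp: patterns_def card_gt_0_iff)
  have "in_Q_sqrt (slice (r - ?c) (\<Prod>i<m. block_series m \<tau> i (i \<in> S)))"
  proof (rule in_Q_sqrt_slices_prod[of _ "r - ?c"])
    fix x i assume "i \<le> r - ?c"
    then have "in_Q_sqrt (slice i (parity_series b))" for b using IH c by auto
    moreover have "slice i (F - H) = slice i F - slice i H" "slice i 0 = 0" for F H
      by (simp_all add: fps_eq_iff)
    ultimately show "in_Q_sqrt (slice i (block_series m \<tau> x (x \<in> S)))"
      using in_Q_sqrt_0 in_Q_sqrt_1 in_Q_sqrt_X
      by (auto simp: block_series_def slice_1 slice_X intro: in_Q_sqrt_diff simp del: fps_to_fls_minus)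
  qed simp
  then show "in_Q_sqrt (slice r (pattern_series m \<tau> S))"
    using c by (simp add: pattern_series_def slice_const_mult)
qed

lemma in_Q_sqrt_slice: "in_Q_sqrt (slice r (parity_series b))"
proof (induction r arbitrary: b rule: less_induct)
  case (less r)
  note Z = in_Q_sqrt_nontrivial[OF less.IH]
  let ?e = "\<lambda>i. slice i (parity_series False)" and ?o = "\<lambda>i. slice i (parity_series True)"
  \<comment> \<open>The equation for the even part involves no slice of index \<open>r\<close> on
    the right, so \<open>?e r\<close> is available for the odd part.\<close>
  have e: "in_Q_sqrt (?e r)"
    unfolding slice_even slice_1 using Z in_Q_sqrt_0 in_Q_sqrt_1 by (intro in_Q_sqrt_add) auto
  have e': "in_Q_sqrt (?e i)" if "i \<le> r" for i
    using less.IH[of i False] e that by (cases "i = r") auto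
  have "in_Q_sqrt (?o r)"
  proof (cases "r = 0")
    case True
    have "2 * fps_X * ?o 0 = 1 - sqrt_series" by (simp add: sqrt_eq)
    then have "in_Q_sqrt (2 * fps_X * ?o 0)"
      using in_Q_sqrt_diff[OF in_Q_sqrt_1 in_Q_sqrt_sqrt] by (simp only:)
    moreover have "in_Q_sqrt (2 * fps_X)"
      using in_Q_sqrt_add[OF in_Q_sqrt_X in_Q_sqrt_X] by (simp only: mult_2)
    ultimately show ?thesis unfolding True by (rule in_Q_sqrt_cancel) simp
  next
    case False
    \<comment> \<open>\<open>Y\<close> gathers the terms already known to lie in the field; the
      extreme terms i = 0 and i = r of the odd convolution are left out because they contain
      \<open>?o r\<close>.\<close>
    define Y where "Y = (\<Sum>i=0..r. ?e i * ?e (r - i)) + (\<Sum>i\<in>{0..r} - {0, r}. ?o i * ?o (r - i))"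
    have "(\<Sum>i=0..r. ?o i * ?o (r - i)) = (\<Sum>i\<in>{0..r} - {0, r}. ?o i * ?o (r - i)) + 2 * ?o 0 * ?o r"
      using False sum.subset_diff[of "{0, r}" "{0..r}" "\<lambda>i. ?o i * ?o (r - i)"] by simp
    then have "?o r = fps_X * (Y + 2 * ?o 0 * ?o r) + nontrivial_series r True"
      by (subst slice_odd) (simp add: slice_add slice_mult power2_eq_square Y_def algebra_simps)
    \<comment> \<open>Moving 2 x o_0 o_r to the left gives \<open>?o r\<close> the factor 1 - 2 x
      o_0, which is the square root by \<open>sqrt_eq\<close>.\<close>
    then have "sqrt_series * ?o r = fps_X * Y + nontrivial_series r True"
      unfolding sqrt_eq by (simp add: algebra_simps)
    moreover have "in_Q_sqrt Y"
      unfolding Y_def using e' less.IH by (intro in_Q_sqrt_add rational_functions_sum in_Q_sqrt_mult) auto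
    then have "in_Q_sqrt (fps_X * Y + nontrivial_series r True)"
      by (intro in_Q_sqrt_add in_Q_sqrt_mult in_Q_sqrt_X Z)
    ultimately have "in_Q_sqrt (sqrt_series * ?o r)" by simp
    moreover have "sqrt_series \<noteq> 0" using sqrt_series_nth_0 by auto
    ultimately show ?thesis using in_Q_sqrt_cancel in_Q_sqrt_sqrt by blast
  qed
  then show ?case using e by (cases b) auto
qed

theorem theorem9:
  fixes r :: nat
  shows "fps_to_fls (M r) \<in> rational_functions_of_X_and (fps_to_fls sqrt_series)"
  unfolding M_eq by (intro in_Q_sqrt_add in_Q_sqrt_slice)

end
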